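(* Let $\mathcal{T}$ be a TBox and $\Sigma\subseteq\mathrm{sig}(\mathcal{T})$ a signature, with settings $\chi_z$, $z\in\{\mathsf m,\mathsf q,\mathsf f,\mathsf i,\mathsf c\}$, as defined in the context. Let $\mathcal{T}'$ be a justification for a first-order sentence $\varphi$ in $\mathcal{T}$, i.e. $\mathcal{T}\models\varphi$ and $\mathcal{T}'$ is a minimal subset of $\mathcal{T}$ such that $\mathcal{T}'\models\varphi$. If $\mathrm{sig}(\varphi)\subseteq\Sigma$, then $\mathcal{T}'\subseteq\mathcal{M}^{\chi_{\mathsf m}}$, and additionally: (i) if $\varphi$ is a rule, then $\mathcal{T}'\subseteq\mathcal{M}^{\chi_{\mathsf q}}$; (ii) if $\varphi$ is datalog, then $\mathcal{T}'\subseteq\mathcal{M}^{\chi_{\mathsf f}}$; (iii) if $\varphi$ is of the form $A(\mathbf{x})\to B(\mathbf{x})$, then $\mathcal{T}'\subseteq\mathcal{M}^{\chi_{\mathsf i}}$. Finally, if $\varphi$ is of the form $A(\mathbf{x})\to B(\mathbf{x})$ with $A\in\Sigma$ and $B\in\mathrm{sig}(\mathcal{T})$ (where $B\in\Sigma$ is not required), then $\mathcal{T}'\subseteq\mathcal{M}^{\chi_{\mathsf c}}$.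
   Context: Rules and TBoxes. Standard first-order logic is used. A signature is a set of predicates; $\mathrm{sig}(F)$ is the signature of a formula or set of formulas $F$; the nullary falsehood predicate $\bot$ is assumed to belong to every signature. A rule is a function-free sentence $\forall\mathbf{x}.[\varphi(\mathbf{x})\to\exists\mathbf{y}.[\bigvee_{i=1}^n\psi_i(\mathbf{x},\mathbf{y})]]$ with the body $\varphi$ and the $\psi_i$ conjunctions of distinct atoms ($n\ge 0$; for $n=0$ the head is the empty disjunction, i.e. $\bot$). Rules are safe (all universally quantified variables in the head occur in the body), and w.l.o.g. the truth symbol $\top$ does not occur in rule heads and $\bot$ does not occur in rule bodies. Universal quantifiers are usually omitted. A TBox is a finite set of rules; TBoxes mentioning equality are extended with its standard axiomatisation. A fact is a function-free ground atom; an ABox is a finite set of facts; a $\Sigma$-ABox is an ABox over the predicates of $\Sigma$. Standing assumptions: $\mathcal{T}$ contains no constants and rules in $\mathcal{T}$ do not share existentially quantified variables. In $A(\mathbf{x})\to B(\mathbf{x})$, $\mathbf{x}$ is a tuple of (w.l.o.g. pairwise distinct) universally quantified variables. Datalog. A rule is datalog if its head has at most one atom and all variables are universally quantified; a datalog program $\mathcal{P}$ is a set of datalog rules. A fact $\gamma$ is a consequence of a datalog rule $\bigwedge_{i=1}^n\gamma_i'\to\delta$ and facts $\gamma_1,\dots,\gamma_n$ if $\gamma=\delta\sigma$ with $\sigma$ a most general unifier of $\gamma_i,\gamma_i'$ for each $1\le i\le n$. A proof of $\gamma$ in $\mathcal{P}\cup\mathcal{A}$ ($\mathcal{A}$ an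 ABox) is a pair $(T,\lambda)$ with $T$ a tree and $\lambda$ mapping nodes of $T$ to facts and edges of $T$ to rules of $\mathcal{P}$, such that for each node $v$: (1) $\lambda(v)=\gamma$ if $v$ is the root; (2) $\lambda(v)\in\mathcal{A}$ if $v$ is a leaf; (3) if $v$ has children $w_1,\dots,w_n$, then all edges from $v$ to the $w_i$ are labelled by the same rule $r$ and $\lambda(v)$ is a consequence of $r$ and $\lambda(w_1),\dots,\lambda(w_n)$. The support of $\gamma$ is the set of rules occurring in some proof of $\gamma$ in $\mathcal{P}\cup\mathcal{A}$. Module settings. A module setting for $\mathcal{T}$ and $\Sigma$ is a tuple $\chi=\langle\theta,\mathcal{A}_0,\mathcal{A}_r\rangle$ with $\theta$ a substitution from the existentially quantified variables of $\mathcal{T}$ to constants, $\mathcal{A}_0$ a $\Sigma$-ABox, $\mathcal{A}_r$ a $\mathrm{sig}(\mathcal{T})$-ABox, and such that no constant in $\chi$ occurs in $\mathcal{T}$. The program $\mathcal{P}^\chi$ is the smallest datalog program containing, for each rule $\varphi(\mathbf{x})\to\exists\mathbf{y}.[\bigvee_{i=1}^n\psi_i(\mathbf{x},\mathbf{y})]$ in $\mathcal{T}$, the following corresponding datalog rules: $\varphi\to\bot$ if $n=0$, and $\varphi\to\gamma\theta$ for each $1\le i\le n$ and each atom $\gamma$ in $\psi_i$. The support of $\chi$ is the set of rules of $\mathcal{P}^\chi$ that support a fact from $\mathcal{A}_r$ in $\mathcal{P}^\chi\cup\mathcal{A}_0$. The module $\mathcal{M}^\chi$ is the set of rules in $\mathcal{T}$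 that have a corresponding datalog rule in the support of $\chi$. The settings $\chi_z=\langle\theta^z,\mathcal{A}_0^z,\mathcal{A}_r^z\rangle$. Let $c_y$ (for each existentially quantified variable $y$ in $\mathcal{T}$), $c_A^1,\dots,c_A^n$ (for each $A\in\Sigma$ of arity $n$) and $\ast$ be fresh constants. - $\theta^{\mathsf i}=\theta^{\mathsf c}=\theta^{\mathsf f}=\theta^{\mathsf q}=\{y\mapsto c_y\mid y\text{ existentially quantified in }\mathcal{T}\}$; $\theta^{\mathsf m}$ maps every such $y$ to $\ast$. - $\mathcal{A}_0^{\mathsf i}=\mathcal{A}_0^{\mathsf c}=\{A(c_A^1,\dots,c_A^n)\mid A\ n\text{-ary predicate in }\Sigma\}$; $\mathcal{A}_0^{\mathsf f}=\mathcal{A}_0^{\mathsf q}=\mathcal{A}_0^{\mathsf m}=\{A(\ast,\dots,\ast)\mid A\in\Sigma\}$. - $\mathcal{A}_r^{\mathsf i}=\{B(c_A^1,\dots,c_A^n)\mid A\ne B\ n\text{-ary predicates in }\Sigma\}$; $\mathcal{A}_r^{\mathsf c}$ consists of all facts $B(c_A^1,\dots,c_A^n)$ such that $A\ne B$ are $n$-ary predicates, $A\in\Sigma$ and $B\in\mathrm{sig}(\mathcal{T})$; $\mathcal{A}_r^{\mathsf f}=\mathcal{A}_r^{\mathsf m}=\mathcal{A}_0^{\mathsf f}$; $\mathcal{A}_r^{\mathsf q}$ consists of all $\Sigma$-facts $A(a_1,\dots,a_n)$ with each $a_j$ either a constant $c_y$ or $\ast$.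
   Formalization: Formally ⊤, like ⊥, belongs to every signature, so ⊤ is in each A_0 and ⊥ in A_r of settings i and c; otherwise rules with body ⊤ or head ⊥ could be lost. Entailment ranges over structures within one infinite type, equivalent by Löwenheim–Skolem. *)

theory Defs
  imports Main
begin

section \<open>First-order logic\<close>

text \<open>A predicate symbol carries its arity. Falsity and truth are logical nullary predicates
  with a fixed interpretation. Both belong to every signature; for truth this supplies the fact
  that a rule with body \<open>\<top>\<close> needs as a leaf in a proof, and it puts the fact \<open>\<bottom>\<close> among the
  relevant facts \<open>B(c\<^sub>A)\<close> with \<open>A \<noteq> B\<close> of the same arity (take \<open>A = \<top>\<close> and \<open>B = \<bottom>\<close>), without
  which rules that derive \<open>\<bottom>\<close> would be lost.\<close>

datatype 'p pred = Falsum | Verum | Pred 'p nat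

fun arity :: "'p pred \<Rightarrow> nat" where
  "arity Falsum = 0"
| "arity Verum = 0"
| "arity (Pred p n) = n"

definition signature :: "'p pred set \<Rightarrow> bool" where
  "signature S \<longleftrightarrow> Falsum \<in> S \<and> Verum \<in> S"

datatype ('f, 'v) tm = Var 'v | Fun 'f "('f, 'v) tm list"

abbreviation Const :: "'f \<Rightarrow> ('f, 'v) tm" where
  "Const c \<equiv> Fun c []"

fun vars_tm :: "('f, 'v) tm \<Rightarrow> 'v set" where
  "vars_tm (Var x) = {x}"
| "vars_tm (Fun f ts) = (\<Union>t\<in>set ts. vars_tm t)"

fun subst_tm :: "('v \<Rightarrow> ('f, 'v) tm) \<Rightarrow> ('f, 'v) tm \<Rightarrow> ('f, 'v) tm" where
  "subst_tm \<sigma> (Var x) = \<sigma> x"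
| "subst_tm \<sigma> (Fun f ts) = Fun f (map (subst_tm \<sigma>) ts)"

datatype ('p, 'f, 'v) atom = Atom (pred_of: "'p pred") (args_of: "('f, 'v) tm list")

definition vars_atom :: "('p, 'f, 'v) atom \<Rightarrow> 'v set" where
  "vars_atom a = (\<Union>t\<in>set (args_of a). vars_tm t)"

definition subst_atom :: "('v \<Rightarrow> ('f, 'v) tm) \<Rightarrow> ('p, 'f, 'v) atom \<Rightarrow> ('p, 'f, 'v) atom" where
  "subst_atom \<sigma> a = Atom (pred_of a) (map (subst_tm \<sigma>) (args_of a))"

datatype ('p, 'f, 'v) fm =
    FAtom "('p, 'f, 'v) atom"
  | Neg "('p, 'f, 'v) fm"
  | Conj "('p, 'f, 'v) fm" "('p, 'f, 'v) fm"
  | Disj "('p, 'f, 'v) fm" "('p, 'f, 'v) fm"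
  | Imp "('p, 'f, 'v) fm" "('p, 'f, 'v) fm"
  | All 'v "('p, 'f, 'v) fm"
  | Ex 'v "('p, 'f, 'v) fm"

fun atoms_fm :: "('p, 'f, 'v) fm \<Rightarrow> ('p, 'f, 'v) atom set" where
  "atoms_fm (FAtom a) = {a}"
| "atoms_fm (Neg F) = atoms_fm F"
| "atoms_fm (Conj F G) = atoms_fm F \<union> atoms_fm G"
| "atoms_fm (Disj F G) = atoms_fm F \<union> atoms_fm G"
| "atoms_fm (Imp F G) = atoms_fm F \<union> atoms_fm G"
| "atoms_fm (All x F) = atoms_fm F"
| "atoms_fm (Ex x F) = atoms_fm F"

fun fv_fm :: "('p, 'f, 'v) fm \<Rightarrow> 'v set" where
  "fv_fm (FAtom a) = vars_atom a"
| "fv_fm (Neg F) = fv_fm F"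
| "fv_fm (Conj F G) = fv_fm F \<union> fv_fm G"
| "fv_fm (Disj F G) = fv_fm F \<union> fv_fm G"
| "fv_fm (Imp F G) = fv_fm F \<union> fv_fm G"
| "fv_fm (All x F) = fv_fm F - {x}"
| "fv_fm (Ex x F) = fv_fm F - {x}"

definition sentence :: "('p, 'f, 'v) fm \<Rightarrow> bool" where
  "sentence F \<longleftrightarrow>
     (\<forall>a\<in>atoms_fm F. length (args_of a) = arity (pred_of a)) \<and> fv_fm F = {}"

definition sig_fm :: "('p, 'f, 'v) fm \<Rightarrow> 'p pred set" where
  "sig_fm F = {Falsum, Verum} \<union> pred_of ` atoms_fm F"

datatype ('p, 'f, 'u) interp =
  Interp (dom_of: "'u set") (fun_of: "'f \<Rightarrow> 'u list \<Rightarrow> 'u") (rel_of: "'p pred \<Rightarrow> 'u list \<Rightarrow> bool")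

definition is_interp :: "('p, 'f, 'u) interp \<Rightarrow> bool" where
  "is_interp I \<longleftrightarrow>
     dom_of I \<noteq> {} \<and>
     (\<forall>f us. set us \<subseteq> dom_of I \<longrightarrow> fun_of I f us \<in> dom_of I) \<and>
     \<not> rel_of I Falsum [] \<and> rel_of I Verum []"

fun eval_tm :: "('p, 'f, 'u) interp \<Rightarrow> ('v \<Rightarrow> 'u) \<Rightarrow> ('f, 'v) tm \<Rightarrow> 'u" where
  "eval_tm I e (Var x) = e x"
| "eval_tm I e (Fun f ts) = fun_of I f (map (eval_tm I e) ts)"

fun eval_fm :: "('p, 'f, 'u) interp \<Rightarrow> ('v \<Rightarrow> 'u) \<Rightarrow> ('p, 'f, 'v) fm \<Rightarrow> bool" where
  "eval_fm I e (FAtom a) \<longleftrightarrow> rel_of I (pred_of a) (map (eval_tm I e) (args_of a))"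
| "eval_fm I e (Neg F) \<longleftrightarrow> \<not> eval_fm I e F"
| "eval_fm I e (Conj F G) \<longleftrightarrow> eval_fm I e F \<and> eval_fm I e G"
| "eval_fm I e (Disj F G) \<longleftrightarrow> eval_fm I e F \<or> eval_fm I e G"
| "eval_fm I e (Imp F G) \<longleftrightarrow> (eval_fm I e F \<longrightarrow> eval_fm I e G)"
| "eval_fm I e (All x F) \<longleftrightarrow> (\<forall>u\<in>dom_of I. eval_fm I (e(x := u)) F)"
| "eval_fm I e (Ex x F) \<longleftrightarrow> (\<exists>u\<in>dom_of I. eval_fm I (e(x := u)) F)"

definition satisfies :: "('p, 'f, 'u) interp \<Rightarrow> ('p, 'f, 'v) fm \<Rightarrow> bool" where
  "satisfies I F \<longleftrightarrow> (\<forall>e. range e \<subseteq> dom_of I \<longrightarrow> eval_fm I e F)"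

text \<open>Entailment over all structures whose domain is a nonempty subset of the type \<open>'u\<close>. HOL
  cannot quantify over types inside a formula; for finitely many premises and an infinite type
  \<open>'u\<close>, this is first-order entailment over arbitrary structures, by the downward
  Loewenheim-Skolem theorem.\<close>

definition entails :: "'u itself \<Rightarrow> ('p, 'f, 'v) fm set \<Rightarrow> ('p, 'f, 'v) fm \<Rightarrow> bool" where
  "entails U S F \<longleftrightarrow>
     (\<forall>I :: ('p, 'f, 'u) interp. is_interp I \<longrightarrow> (\<forall>G\<in>S. satisfies I G) \<longrightarrow> satisfies I F)"


section \<open>Rules and TBoxes\<close>

text \<open>\<open>Rule xs \<phi> ys [\<psi>\<^sub>1, \<dots>, \<psi>\<^sub>n]\<close> stands for the sentence
  \<open>\<forall>xs. [\<phi> \<rightarrow> \<exists>ys. [\<psi>\<^sub>1 \<or> \<dots> \<or> \<psi>\<^sub>n]]\<close>; conjunctions of atoms are lists.\<close>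

datatype ('p, 'f, 'v) rule = Rule
  (uvars: "'v list")
  (body: "('p, 'f, 'v) atom list")
  (evars: "'v list")
  (heads: "('p, 'f, 'v) atom list list")

fun conj_list :: "('p, 'f, 'v) fm list \<Rightarrow> ('p, 'f, 'v) fm" where
  "conj_list [] = FAtom (Atom Verum [])"
| "conj_list [F] = F"
| "conj_list (F # G # Fs) = Conj F (conj_list (G # Fs))"

fun disj_list :: "('p, 'f, 'v) fm list \<Rightarrow> ('p, 'f, 'v) fm" where
  "disj_list [] = FAtom (Atom Falsum [])"
| "disj_list [F] = F"
| "disj_list (F # G # Fs) = Disj F (disj_list (G # Fs))"

definition fm_of_rule :: "('p, 'f, 'v) rule \<Rightarrow> ('p, 'f, 'v) fm" where
  "fm_of_rule r =
     foldr All (uvars r)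
       (Imp (conj_list (map FAtom (body r)))
            (foldr Ex (evars r) (disj_list (map (\<lambda>\<psi>. conj_list (map FAtom \<psi>)) (heads r)))))"

definition atoms_rule :: "('p, 'f, 'v) rule \<Rightarrow> ('p, 'f, 'v) atom set" where
  "atoms_rule r = set (body r) \<union> (\<Union>\<psi>\<in>set (heads r). set \<psi>)"

text \<open>Function-free: every argument is a variable or a constant.\<close>

definition flat_atom :: "('p, 'f, 'v) atom \<Rightarrow> bool" where
  "flat_atom a \<longleftrightarrow>
     length (args_of a) = arity (pred_of a) \<and>
     (\<forall>t\<in>set (args_of a). (\<exists>x. t = Var x) \<or> (\<exists>c. t = Const c))"

text \<open>An empty body is written \<open>\<top>\<close>, that is, as \<open>[Atom Verum []]\<close>; hence bodies are nonempty
  lists. The last conjunct is safety.\<close>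

definition is_rule :: "('p, 'f, 'v) rule \<Rightarrow> bool" where
  "is_rule r \<longleftrightarrow>
     distinct (uvars r @ evars r) \<and>
     (\<forall>a\<in>atoms_rule r. flat_atom a) \<and>
     body r \<noteq> [] \<and> distinct (body r) \<and>
     (\<forall>a\<in>set (body r). pred_of a \<noteq> Falsum \<and> vars_atom a \<subseteq> set (uvars r)) \<and>
     (\<forall>\<psi>\<in>set (heads r). \<psi> \<noteq> [] \<and> distinct \<psi> \<and>
        (\<forall>a\<in>set \<psi>. pred_of a \<noteq> Verum \<and> vars_atom a \<subseteq> set (uvars r) \<union> set (evars r))) \<and>
     (\<forall>\<psi>\<in>set (heads r). \<forall>a\<in>set \<psi>. vars_atom a \<inter> set (uvars r) \<subseteq> (\<Union>b\<in>set (body r). vars_atom b))"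

definition is_datalog :: "('p, 'f, 'v) rule \<Rightarrow> bool" where
  "is_datalog r \<longleftrightarrow> is_rule r \<and> evars r = [] \<and> (heads r = [] \<or> (\<exists>a. heads r = [[a]]))"

definition atomic_implication :: "'p pred \<Rightarrow> 'p pred \<Rightarrow> 'v list \<Rightarrow> ('p, 'f, 'v) rule" where
  "atomic_implication A B xs = Rule xs [Atom A (map Var xs)] [] [[Atom B (map Var xs)]]"

definition is_atomic_implication :: "('p, 'f, 'v) fm \<Rightarrow> 'p pred \<Rightarrow> 'p pred \<Rightarrow> bool" where
  "is_atomic_implication F A B \<longleftrightarrow>
     (\<exists>xs. distinct xs \<and> length xs = arity A \<and> length xs = arity B \<and>
           F = fm_of_rule (atomic_implication A B xs))"

definition constant_free :: "('p, 'f, 'v) rule \<Rightarrow> bool" where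
  "constant_free r \<longleftrightarrow> (\<forall>a\<in>atoms_rule r. \<forall>c. Const c \<notin> set (args_of a))"

definition evars_tbox :: "('p, 'f, 'v) rule set \<Rightarrow> 'v set" where
  "evars_tbox T = (\<Union>r\<in>T. set (evars r))"

definition sig_tbox :: "('p, 'f, 'v) rule set \<Rightarrow> 'p pred set" where
  "sig_tbox T = {Falsum, Verum} \<union> (\<Union>r\<in>T. pred_of ` atoms_rule r)"


text \<open>Equality is an ordinary binary predicate; a TBox that mentions it contains the rules
  axiomatising it.\<close>

definition is_tbox :: "('p, 'f, 'v) rule set \<Rightarrow> bool" where
  "is_tbox T \<longleftrightarrow> finite T \<and> (\<forall>r\<in>T. is_rule r)"

definition no_shared_evars :: "('p, 'f, 'v) rule set \<Rightarrow> bool" where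
  "no_shared_evars T \<longleftrightarrow> (\<forall>r\<in>T. \<forall>s\<in>T. r \<noteq> s \<longrightarrow> set (evars r) \<inter> set (evars s) = {})"

definition is_justification ::
  "'u itself \<Rightarrow> ('p, 'f, 'v) rule set \<Rightarrow> ('p, 'f, 'v) fm \<Rightarrow> ('p, 'f, 'v) rule set \<Rightarrow> bool" where
  "is_justification U T F T' \<longleftrightarrow>
     entails U (fm_of_rule ` T) F \<and> T' \<subseteq> T \<and> entails U (fm_of_rule ` T') F \<and>
     (\<forall>S. S \<subset> T' \<longrightarrow> \<not> entails U (fm_of_rule ` S) F)"


section \<open>Datalog\<close>

definition ground_atom :: "'p pred \<Rightarrow> 'f list \<Rightarrow> ('p, 'f, 'v) atom" where
  "ground_atom A cs = Atom A (map Const cs)"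

definition is_fact :: "('p, 'f, 'v) atom \<Rightarrow> bool" where
  "is_fact a \<longleftrightarrow> (\<exists>A cs. length cs = arity A \<and> a = ground_atom A cs)"

definition is_abox :: "'p pred set \<Rightarrow> ('p, 'f, 'v) atom set \<Rightarrow> bool" where
  "is_abox S \<A> \<longleftrightarrow> finite \<A> \<and> (\<forall>a\<in>\<A>. is_fact a \<and> pred_of a \<in> S)"

text \<open>All variables of a datalog rule are universally quantified, so no prefix is kept. The empty
  head is written \<open>\<bottom>\<close>.\<close>

datatype ('p, 'f, 'v) drule =
  DRule (dbody: "('p, 'f, 'v) atom list") (dhead: "('p, 'f, 'v) atom")

definition unifies ::
  "('v \<Rightarrow> ('f, 'v) tm) \<Rightarrow> (('p, 'f, 'v) atom \<times> ('p, 'f, 'v) atom) set \<Rightarrow> bool" where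
  "unifies \<sigma> E \<longleftrightarrow> (\<forall>(a, b)\<in>E. subst_atom \<sigma> a = subst_atom \<sigma> b)"

text \<open>A simultaneous most general unifier of all pairs in \<open>E\<close>.\<close>

definition is_mgu ::
  "('v \<Rightarrow> ('f, 'v) tm) \<Rightarrow> (('p, 'f, 'v) atom \<times> ('p, 'f, 'v) atom) set \<Rightarrow> bool" where
  "is_mgu \<sigma> E \<longleftrightarrow>
     unifies \<sigma> E \<and> (\<forall>\<tau>. unifies \<tau> E \<longrightarrow> (\<exists>\<rho>. \<forall>x. \<tau> x = subst_tm \<rho> (\<sigma> x)))"

definition consequence ::
  "('p, 'f, 'v) atom \<Rightarrow> ('p, 'f, 'v) drule \<Rightarrow> ('p, 'f, 'v) atom list \<Rightarrow> bool" where
  "consequence g r gs \<longleftrightarrow>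
     length gs = length (dbody r) \<and>
     (\<exists>\<sigma>. is_mgu \<sigma> (set (zip gs (dbody r))) \<and> g = subst_atom \<sigma> (dhead r))"

text \<open>A finite tree whose nodes are labelled by facts and whose edges are labelled by datalog
  rules: \<open>Node g [(r\<^sub>1, t\<^sub>1), \<dots>, (r\<^sub>n, t\<^sub>n)]\<close> has the edge to the root of \<open>t\<^sub>i\<close> labelled \<open>r\<^sub>i\<close>.\<close>

datatype ('p, 'f, 'v) ptree =
  Node (root: "('p, 'f, 'v) atom") "(('p, 'f, 'v) drule \<times> ('p, 'f, 'v) ptree) list"

inductive is_proof ::
  "('p, 'f, 'v) drule set \<Rightarrow> ('p, 'f, 'v) atom set \<Rightarrow> ('p, 'f, 'v) ptree \<Rightarrow> bool"
  for P \<A> where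
  leaf: "is_fact g \<Longrightarrow> g \<in> \<A> \<Longrightarrow> is_proof P \<A> (Node g [])"
| inner: "is_fact g \<Longrightarrow> ks \<noteq> [] \<Longrightarrow> r \<in> P \<Longrightarrow> \<forall>k\<in>set ks. fst k = r \<Longrightarrow>
    consequence g r (map (\<lambda>k. root (snd k)) ks) \<Longrightarrow>
    \<forall>k\<in>set ks. is_proof P \<A> (snd k) \<Longrightarrow> is_proof P \<A> (Node g ks)"

fun proof_rules :: "('p, 'f, 'v) ptree \<Rightarrow> ('p, 'f, 'v) drule set" where
  "proof_rules (Node g ks) = (\<Union>(r, t)\<in>set ks. insert r (proof_rules t))"

definition support_fact ::
  "('p, 'f, 'v) drule set \<Rightarrow> ('p, 'f, 'v) atom set \<Rightarrow> ('p, 'f, 'v) atom \<Rightarrow> ('p, 'f, 'v) drule set"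
  where
  "support_fact P \<A> g = (\<Union>t\<in>{t. is_proof P \<A> t \<and> root t = g}. proof_rules t)"


section \<open>Module settings and modules\<close>

text \<open>A setting \<open>(\<theta>, \<A>\<^sub>0, \<A>\<^sub>r)\<close>.\<close>

type_synonym ('p, 'f, 'v) setting =
  "('v \<rightharpoonup> 'f) \<times> ('p, 'f, 'v) atom set \<times> ('p, 'f, 'v) atom set"

definition consts_rule :: "('p, 'f, 'v) rule \<Rightarrow> 'f set" where
  "consts_rule r = {c. \<exists>a\<in>atoms_rule r. Const c \<in> set (args_of a)}"

definition consts_setting :: "('p, 'f, 'v) setting \<Rightarrow> 'f set" where
  "consts_setting \<chi> = (case \<chi> of (\<theta>, \<A>0, \<A>r) \<Rightarrow>
     ran \<theta> \<union> {c. \<exists>a\<in>\<A>0 \<union> \<A>r. Const c \<in> set (args_of a)})"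

definition is_setting ::
  "('p, 'f, 'v) rule set \<Rightarrow> 'p pred set \<Rightarrow> ('p, 'f, 'v) setting \<Rightarrow> bool" where
  "is_setting T \<Sigma> \<chi> \<longleftrightarrow> (case \<chi> of (\<theta>, \<A>0, \<A>r) \<Rightarrow>
     dom \<theta> = evars_tbox T \<and> is_abox \<Sigma> \<A>0 \<and> is_abox (sig_tbox T) \<A>r \<and>
     (\<forall>r\<in>T. consts_rule r \<inter> consts_setting \<chi> = {}))"

definition subst_of :: "('v \<rightharpoonup> 'f) \<Rightarrow> 'v \<Rightarrow> ('f, 'v) tm" where
  "subst_of \<theta> x = (case \<theta> x of None \<Rightarrow> Var x | Some c \<Rightarrow> Const c)"

text \<open>The setting instantiates existentially quantified occurrences only: a variable that is
  universally quantified in \<open>r\<close> is left alone even if another rule quantifies it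
  existentially.\<close>

definition corresponding :: "('v \<rightharpoonup> 'f) \<Rightarrow> ('p, 'f, 'v) rule \<Rightarrow> ('p, 'f, 'v) drule set" where
  "corresponding \<theta> r =
     (if heads r = [] then {DRule (body r) (Atom Falsum [])}
      else {DRule (body r) (subst_atom (subst_of (\<theta> |` set (evars r))) g) | \<psi> g.
              \<psi> \<in> set (heads r) \<and> g \<in> set \<psi>})"

definition program ::
  "('p, 'f, 'v) rule set \<Rightarrow> ('p, 'f, 'v) setting \<Rightarrow> ('p, 'f, 'v) drule set" where
  "program T \<chi> = (case \<chi> of (\<theta>, \<A>0, \<A>r) \<Rightarrow> \<Union>r\<in>T. corresponding \<theta> r)"

definition support ::
  "('p, 'f, 'v) rule set \<Rightarrow> ('p, 'f, 'v) setting \<Rightarrow> ('p, 'f, 'v) drule set" where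
  "support T \<chi> = (case \<chi> of (\<theta>, \<A>0, \<A>r) \<Rightarrow> \<Union>g\<in>\<A>r. support_fact (program T \<chi>) \<A>0 g)"

definition module ::
  "('p, 'f, 'v) rule set \<Rightarrow> ('p, 'f, 'v) setting \<Rightarrow> ('p, 'f, 'v) rule set" where
  "module T \<chi> = (case \<chi> of (\<theta>, \<A>0, \<A>r) \<Rightarrow> {r \<in> T. corresponding \<theta> r \<inter> support T \<chi> \<noteq> {}})"


section \<open>The five settings\<close>

text \<open>The constants \<open>c\<^sub>y\<close>, \<open>c\<^sub>A\<^sup>j\<close> (for \<open>1 \<le> j \<le> arity A\<close>) and \<open>*\<close> are \<open>cy y\<close>, \<open>cp A j\<close> and \<open>st\<close>.\<close>

definition fresh_constants ::
  "('p, 'f, 'v) rule set \<Rightarrow> 'p pred set \<Rightarrow> ('v \<Rightarrow> 'f) \<Rightarrow> ('p pred \<Rightarrow> nat \<Rightarrow> 'f) \<Rightarrow> 'f \<Rightarrow> bool" where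
  "fresh_constants T \<Sigma> cy cp st \<longleftrightarrow>
     (let Y = evars_tbox T;
          J = {(A, j). A \<in> \<Sigma> \<and> 1 \<le> j \<and> j \<le> arity A};
          f = (\<lambda>(A, j). cp A j)
      in inj_on cy Y \<and> inj_on f J \<and> cy ` Y \<inter> f ` J = {} \<and> st \<notin> cy ` Y \<and> st \<notin> f ` J \<and>
         (\<forall>r\<in>T. consts_rule r \<inter> (cy ` Y \<union> f ` J \<union> {st}) = {}))"

definition tuple :: "('p pred \<Rightarrow> nat \<Rightarrow> 'f) \<Rightarrow> 'p pred \<Rightarrow> 'f list" where
  "tuple cp A = map (cp A) [1..<Suc (arity A)]"

definition theta_c :: "('p, 'f, 'v) rule set \<Rightarrow> ('v \<Rightarrow> 'f) \<Rightarrow> 'v \<rightharpoonup> 'f" where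
  "theta_c T cy = (\<lambda>y. if y \<in> evars_tbox T then Some (cy y) else None)"

definition theta_m :: "('p, 'f, 'v) rule set \<Rightarrow> 'f \<Rightarrow> 'v \<rightharpoonup> 'f" where
  "theta_m T st = (\<lambda>y. if y \<in> evars_tbox T then Some st else None)"

definition A0_i :: "'p pred set \<Rightarrow> ('p pred \<Rightarrow> nat \<Rightarrow> 'f) \<Rightarrow> ('p, 'f, 'v) atom set" where
  "A0_i \<Sigma> cp = {ground_atom A (tuple cp A) | A. A \<in> \<Sigma>}"

definition A0_f :: "'p pred set \<Rightarrow> 'f \<Rightarrow> ('p, 'f, 'v) atom set" where
  "A0_f \<Sigma> st = {ground_atom A (replicate (arity A) st) | A. A \<in> \<Sigma>}"

definition Ar_i :: "'p pred set \<Rightarrow> ('p pred \<Rightarrow> nat \<Rightarrow> 'f) \<Rightarrow> ('p, 'f, 'v) atom set" where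
  "Ar_i \<Sigma> cp =
     {ground_atom B (tuple cp A) | A B. A \<in> \<Sigma> \<and> B \<in> \<Sigma> \<and> A \<noteq> B \<and> arity A = arity B}"

definition Ar_c ::
  "('p, 'f, 'v) rule set \<Rightarrow> 'p pred set \<Rightarrow> ('p pred \<Rightarrow> nat \<Rightarrow> 'f) \<Rightarrow> ('p, 'f, 'v) atom set" where
  "Ar_c T \<Sigma> cp =
     {ground_atom B (tuple cp A) | A B. A \<in> \<Sigma> \<and> B \<in> sig_tbox T \<and> A \<noteq> B \<and> arity A = arity B}"

definition Ar_q ::
  "('p, 'f, 'v) rule set \<Rightarrow> 'p pred set \<Rightarrow> ('v \<Rightarrow> 'f) \<Rightarrow> 'f \<Rightarrow> ('p, 'f, 'v) atom set" where
  "Ar_q T \<Sigma> cy st =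
     {ground_atom A cs | A cs. A \<in> \<Sigma> \<and> length cs = arity A \<and> set cs \<subseteq> cy ` evars_tbox T \<union> {st}}"

definition setting_i ::
  "('p, 'f, 'v) rule set \<Rightarrow> 'p pred set \<Rightarrow> ('v \<Rightarrow> 'f) \<Rightarrow> ('p pred \<Rightarrow> nat \<Rightarrow> 'f) \<Rightarrow> ('p, 'f, 'v) setting"
  where "setting_i T \<Sigma> cy cp = (theta_c T cy, A0_i \<Sigma> cp, Ar_i \<Sigma> cp)"

definition setting_c ::
  "('p, 'f, 'v) rule set \<Rightarrow> 'p pred set \<Rightarrow> ('v \<Rightarrow> 'f) \<Rightarrow> ('p pred \<Rightarrow> nat \<Rightarrow> 'f) \<Rightarrow> ('p, 'f, 'v) setting"
  where "setting_c T \<Sigma> cy cp = (theta_c T cy, A0_i \<Sigma> cp, Ar_c T \<Sigma> cp)"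

definition setting_f ::
  "('p, 'f, 'v) rule set \<Rightarrow> 'p pred set \<Rightarrow> ('v \<Rightarrow> 'f) \<Rightarrow> 'f \<Rightarrow> ('p, 'f, 'v) setting"
  where "setting_f T \<Sigma> cy st = (theta_c T cy, A0_f \<Sigma> st, A0_f \<Sigma> st)"

definition setting_q ::
  "('p, 'f, 'v) rule set \<Rightarrow> 'p pred set \<Rightarrow> ('v \<Rightarrow> 'f) \<Rightarrow> 'f \<Rightarrow> ('p, 'f, 'v) setting"
  where "setting_q T \<Sigma> cy st = (theta_c T cy, A0_f \<Sigma> st, Ar_q T \<Sigma> cy st)"

definition setting_m ::
  "('p, 'f, 'v) rule set \<Rightarrow> 'p pred set \<Rightarrow> 'f \<Rightarrow> ('p, 'f, 'v) setting"
  where "setting_m T \<Sigma> st = (theta_m T st, A0_f \<Sigma> st, A0_f \<Sigma> st)"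


lemma settings_are_settings:
  fixes T :: "('p, 'f, 'v) rule set"
  assumes "is_tbox T" "\<forall>r\<in>T. constant_free r" "signature \<Sigma>" "\<Sigma> \<subseteq> sig_tbox T"
  shows "is_setting T \<Sigma> (setting_i T \<Sigma> cy cp)" "is_setting T \<Sigma> (setting_c T \<Sigma> cy cp)"
    "is_setting T \<Sigma> (setting_f T \<Sigma> cy st)" "is_setting T \<Sigma> (setting_q T \<Sigma> cy st)"
    "is_setting T \<Sigma> (setting_m T \<Sigma> st)"
proof -
  have finT: "finite (sig_tbox T)"
    using assms(1) by (auto simp: is_tbox_def sig_tbox_def atoms_rule_def)
  have fin: "finite \<Sigma>" using finT assms(4) by (rule rev_finite_subset)
  have finY: "finite (cy ` evars_tbox T \<union> {st})"
    using assms(1) by (auto simp: is_tbox_def evars_tbox_def)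
  have con: "consts_rule r = {}" if "r \<in> T" for r
    using assms(2) that by (auto simp: consts_rule_def constant_free_def)
  have dom: "dom (theta_c T cy) = evars_tbox T" "dom (theta_m T st) = evars_tbox T"
    by (auto simp: theta_c_def theta_m_def dom_def)
  have len: "length (tuple cp A) = arity A" for A by (simp add: tuple_def)
  have pred: "pred_of (ground_atom A cs :: ('p, 'f, 'v) atom) = A" for A cs
    by (simp add: ground_atom_def)
  have fact: "is_fact (ground_atom A cs :: ('p, 'f, 'v) atom)" if "length cs = arity A" for A cs
    using that by (auto simp: is_fact_def)
  have i0: "is_abox \<Sigma> (A0_i \<Sigma> cp :: ('p, 'f, 'v) atom set)"
    using fin by (auto simp: is_abox_def A0_i_def pred len intro!: fact)
  have f0: "is_abox \<Sigma> (A0_f \<Sigma> st :: ('p, 'f, 'v) atom set)"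
    using fin by (auto simp: is_abox_def A0_f_def pred intro!: fact)
  have c: "is_abox (sig_tbox T) (Ar_c T \<Sigma> cp :: ('p, 'f, 'v) atom set)"
  proof -
    have "Ar_c T \<Sigma> cp \<subseteq> (\<lambda>(A, B). ground_atom B (tuple cp A)) ` (\<Sigma> \<times> sig_tbox T)"
      by (auto simp: Ar_c_def)
    then have "finite (Ar_c T \<Sigma> cp :: ('p, 'f, 'v) atom set)"
      using fin finT by (meson finite_SigmaI finite_imageI finite_subset)
    then show ?thesis by (auto simp: is_abox_def Ar_c_def pred len intro!: fact)
  qed
  have i: "is_abox (sig_tbox T) (Ar_i \<Sigma> cp :: ('p, 'f, 'v) atom set)"
  proof -
    have "(Ar_i \<Sigma> cp :: ('p, 'f, 'v) atom set) \<subseteq> Ar_c T \<Sigma> cp"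
      using assms(4) by (auto simp: Ar_i_def Ar_c_def)
    then show ?thesis using c by (meson finite_subset is_abox_def subset_iff)
  qed
  have q: "is_abox (sig_tbox T) (Ar_q T \<Sigma> cy st :: ('p, 'f, 'v) atom set)"
  proof -
    let ?Y = "cy ` evars_tbox T \<union> {st}"
    have "Ar_q T \<Sigma> cy st =
        (\<Union>A\<in>\<Sigma>. ground_atom A ` {cs. set cs \<subseteq> ?Y \<and> length cs = arity A})"
      by (auto simp: Ar_q_def)
    then have "finite (Ar_q T \<Sigma> cy st :: ('p, 'f, 'v) atom set)"
      using fin finite_lists_length_eq[OF finY] by simp
    then show ?thesis using assms(4) by (auto simp: is_abox_def Ar_q_def pred intro!: fact)
  qed
  have f: "is_abox (sig_tbox T) (A0_f \<Sigma> st :: ('p, 'f, 'v) atom set)"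
    using f0 assms(4) by (auto simp: is_abox_def)
  show "is_setting T \<Sigma> (setting_i T \<Sigma> cy cp)" "is_setting T \<Sigma> (setting_c T \<Sigma> cy cp)"
    "is_setting T \<Sigma> (setting_f T \<Sigma> cy st)" "is_setting T \<Sigma> (setting_q T \<Sigma> cy st)"
    "is_setting T \<Sigma> (setting_m T \<Sigma> st)"
    using con dom i0 f0 c i q f
    by (simp_all add: is_setting_def setting_i_def setting_c_def setting_f_def setting_q_def
        setting_m_def)
qed

end

theory Submission
  imports Defs
begin

text \<open>Let \<open>M\<close> be the module. By minimality of the justification \<open>T'\<close>, it suffices that
  \<open>T' \<inter> M\<close> entails \<open>F\<close>. Suppose \<open>I\<close> is a model of \<open>T' \<inter> M\<close> that violates \<open>F\<close>. Its product
  with the set of constants of the setting becomes a model \<open>J\<close> of \<open>T'\<close> if a fact about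
  elements \<open>(d\<^sub>i, c\<^sub>i)\<close> holds in \<open>J\<close> iff the fact about the \<open>c\<^sub>i\<close> is derivable in the datalog
  program and, in case it occurs in some proof of a fact from \<open>\<A>\<^sub>r\<close>, the fact about the \<open>d\<^sub>i\<close>
  holds in \<open>I\<close>. Existential variables \<open>y\<close> are witnessed by elements with second component
  \<open>y\<theta>\<close>. A rule outside \<open>M\<close> only produces derivable facts that occur in no such proof; for
  a rule in \<open>M\<close> whose instance produces an occurring fact, the body facts occur as well, and
  the rule holds in \<open>I\<close>. A violation of \<open>F\<close> lifts to \<open>J\<close> by tagging the value of every
  universally quantified variable with \<open>*\<close>, or the value of \<open>x\<^sub>j\<close> with \<open>c\<^sub>A\<^sup>j\<close> if \<open>F\<close> is
  \<open>A(x) \<rightarrow> B(x)\<close>: the tagged body is in \<open>\<A>\<^sub>0\<close>, and a tagged head fact is in \<open>\<A>\<^sub>r\<close>, so it holds in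
  \<open>J\<close> only if it holds in \<open>I\<close>.\<close>

section \<open>Semantics of rules\<close>

definition holds :: "('p, 'f, 'u) interp \<Rightarrow> ('v \<Rightarrow> 'u) \<Rightarrow> ('p, 'f, 'v) atom \<Rightarrow> bool" where
  "holds I e a \<longleftrightarrow> rel_of I (pred_of a) (map (eval_tm I e) (args_of a))"

lemma eval_conj_list:
  assumes "is_interp I"
  shows "eval_fm I e (conj_list Fs) \<longleftrightarrow> (\<forall>F\<in>set Fs. eval_fm I e F)"
  using assms by (induction Fs rule: conj_list.induct) (auto simp: is_interp_def)

lemma eval_disj_list:
  assumes "is_interp I"
  shows "eval_fm I e (disj_list Fs) \<longleftrightarrow> (\<exists>F\<in>set Fs. eval_fm I e F)"
  using assms by (induction Fs rule: disj_list.induct) (auto simp: is_interp_def)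

lemma satisfies_All:
  fixes I :: "('p, 'f, 'u) interp" and F :: "('p, 'f, 'v) fm"
  shows "satisfies I (All x F) \<longleftrightarrow> satisfies I F"
proof
  assume l: "satisfies I (All x F)"
  show "satisfies I F"
    unfolding satisfies_def
  proof (intro allI impI)
    fix e :: "'v \<Rightarrow> 'u" assume e: "range e \<subseteq> dom_of I"
    then have "e x \<in> dom_of I" by auto
    moreover have "eval_fm I e (All x F)" using l e by (simp add: satisfies_def)
    ultimately have "eval_fm I (e(x := e x)) F" by (auto simp del: fun_upd_triv)
    then show "eval_fm I e F" by simp
  qed
next
  assume r: "satisfies I F"
  show "satisfies I (All x F)"
    unfolding satisfies_def
  proof (intro allI impI)
    fix e :: "'v \<Rightarrow> 'u" assume "range e \<subseteq> dom_of I"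
    then have "range (e(x := u)) \<subseteq> dom_of I" if "u \<in> dom_of I" for u
      using that by (auto split: if_splits)
    then show "eval_fm I e (All x F)" using r by (simp add: satisfies_def)
  qed
qed

lemma satisfies_Alls: "satisfies I (foldr All xs F) \<longleftrightarrow> satisfies I F"
  by (induction xs) (simp_all add: satisfies_All)

text \<open>The whole prefix becomes one choice of an assignment, so that all witnesses of a rule
  can be built at once in the product.\<close>

lemma eval_Exs:
  assumes "range e \<subseteq> dom_of I"
  shows "eval_fm I e (foldr Ex ys F) \<longleftrightarrow>
    (\<exists>e'. range e' \<subseteq> dom_of I \<and> (\<forall>x. x \<notin> set ys \<longrightarrow> e' x = e x) \<and> eval_fm I e' F)"
  using assms
proof (induction ys arbitrary: e)
  case Nil
  then show ?case by (auto simp flip: fun_eq_iff)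
next
  case (Cons y ys)
  have upd: "range (e(y := u)) \<subseteq> dom_of I" if "u \<in> dom_of I" for u
    using that Cons.prems by (auto split: if_splits)
  show ?case
  proof
    assume "eval_fm I e (foldr Ex (y # ys) F)"
    then obtain u where u: "u \<in> dom_of I" "eval_fm I (e(y := u)) (foldr Ex ys F)" by auto
    then obtain e' where "range e' \<subseteq> dom_of I" "\<forall>x. x \<notin> set ys \<longrightarrow> e' x = (e(y := u)) x"
      "eval_fm I e' F"
      using Cons.IH[OF upd[OF u(1)]] by blast
    then show "\<exists>e'. range e' \<subseteq> dom_of I \<and> (\<forall>x. x \<notin> set (y # ys) \<longrightarrow> e' x = e x) \<and> eval_fm I e' F"
      by (intro exI[of _ e']) auto
  next
    assume "\<exists>e'. range e' \<subseteq> dom_of I \<and> (\<forall>x. x \<notin> set (y # ys) \<longrightarrow> e' x = e x) \<and> eval_fm I e' F"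
    then obtain e' where e': "range e' \<subseteq> dom_of I" "\<forall>x. x \<notin> set (y # ys) \<longrightarrow> e' x = e x"
      "eval_fm I e' F" by blast
    have u: "e' y \<in> dom_of I" using e'(1) by auto
    have "\<forall>x. x \<notin> set ys \<longrightarrow> e' x = (e(y := e' y)) x" using e'(2) by auto
    then have "eval_fm I (e(y := e' y)) (foldr Ex ys F)"
      using Cons.IH[OF upd[OF u]] e'(1,3) by blast
    then show "eval_fm I e (foldr Ex (y # ys) F)" using u by auto
  qed
qed

lemma satisfies_rule:
  assumes "is_interp I"
  shows "satisfies I (fm_of_rule r) \<longleftrightarrow>
    (\<forall>e. range e \<subseteq> dom_of I \<longrightarrow> (\<forall>a\<in>set (body r). holds I e a) \<longrightarrow>
      (\<exists>e'. range e' \<subseteq> dom_of I \<and> (\<forall>x. x \<notin> set (evars r) \<longrightarrow> e' x = e x) \<and>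
        (\<exists>\<psi>\<in>set (heads r). \<forall>a\<in>set \<psi>. holds I e' a)))"
proof -
  have "satisfies I (fm_of_rule r) \<longleftrightarrow>
      satisfies I (Imp (conj_list (map FAtom (body r)))
        (foldr Ex (evars r) (disj_list (map (\<lambda>\<psi>. conj_list (map FAtom \<psi>)) (heads r)))))"
    by (simp add: fm_of_rule_def satisfies_Alls)
  then show ?thesis
    using assms unfolding satisfies_def
    by (simp add: eval_Exs eval_conj_list eval_disj_list holds_def cong: conj_cong)
qed

lemma satisfies_atomic_implication:
  fixes I :: "('p, 'f, 'u) interp" and xs :: "'v list"
  assumes "is_interp I"
  shows "satisfies I (fm_of_rule (atomic_implication A B xs)) \<longleftrightarrow>
    (\<forall>e. range e \<subseteq> dom_of I \<longrightarrow> holds I e (Atom A (map Var xs)) \<longrightarrow> holds I e (Atom B (map Var xs)))"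
proof -
  have "(\<exists>e'. range e' \<subseteq> dom_of I \<and> (\<forall>x. e' x = e x) \<and> holds I e' a) \<longleftrightarrow>
      range e \<subseteq> dom_of I \<and> holds I e a"
    for e :: "'v \<Rightarrow> 'u" and a :: "('p, 'f, 'v) atom"
    by (auto simp flip: fun_eq_iff)
  then show ?thesis
    by (auto simp: satisfies_rule[OF assms] atomic_implication_def)
qed

section \<open>Derivability and relevance\<close>

lemma subst_tm_eq_iff: "subst_tm \<sigma> t = subst_tm \<tau> t \<longleftrightarrow> (\<forall>x\<in>vars_tm t. \<sigma> x = \<tau> x)"
  by (induction t) auto

lemma subst_atom_eq_iff:
  "subst_atom \<sigma> a = subst_atom \<tau> a \<longleftrightarrow> (\<forall>x\<in>vars_atom a. \<sigma> x = \<tau> x)"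
  by (auto simp: subst_atom_def vars_atom_def subst_tm_eq_iff)

lemma subst_tm_subst_tm: "subst_tm \<rho> (subst_tm \<sigma> t) = subst_tm (\<lambda>x. subst_tm \<rho> (\<sigma> x)) t"
  by (induction t) auto

lemma subst_atom_subst_atom:
  "subst_atom \<rho> (subst_atom \<sigma> a) = subst_atom (\<lambda>x. subst_tm \<rho> (\<sigma> x)) a"
  by (simp add: subst_atom_def subst_tm_subst_tm)

lemma vars_subst_tm: "vars_tm (subst_tm \<sigma> t) = (\<Union>x\<in>vars_tm t. vars_tm (\<sigma> x))"
  by (induction t) auto

lemma vars_subst_atom: "vars_atom (subst_atom \<sigma> a) = (\<Union>x\<in>vars_atom a. vars_tm (\<sigma> x))"
  by (simp add: vars_atom_def subst_atom_def vars_subst_tm)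

abbreviation inst :: "('v \<Rightarrow> 'f) \<Rightarrow> ('p, 'f, 'v) atom \<Rightarrow> ('p, 'f, 'v) atom" where
  "inst \<sigma> \<equiv> subst_atom (\<lambda>x. Const (\<sigma> x))"

lemma subst_inst: "subst_atom \<rho> (inst \<sigma> a) = inst \<sigma> a"
  by (simp add: subst_atom_subst_atom)

text \<open>The instance of the body is ground, so every unifier sends each body variable
  \<open>x\<close> to the constant \<open>\<sigma> x\<close>. Hence \<sigma> on the body variables,
  and the identity elsewhere, is most general.\<close>

lemma consequence_inst:
  assumes "vars_atom H \<subseteq> (\<Union>b\<in>set bs. vars_atom b)"
  shows "consequence (inst \<sigma> H) (DRule bs H) (map (inst \<sigma>) bs)"
proof -
  let ?V = "\<Union>b\<in>set bs. vars_atom b"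
  let ?E = "set (zip (map (inst \<sigma>) bs) bs)"
  define \<mu> where "\<mu> x = (if x \<in> ?V then Const (\<sigma> x) else Var x)" for x
  have E: "?E = (\<lambda>b. (inst \<sigma> b, b)) ` set bs"
    by (simp add: zip_map1 zip_same_conv_map image_image)
  have \<mu>: "subst_atom \<mu> a = inst \<sigma> a" if "vars_atom a \<subseteq> ?V" for a
    using that by (auto simp: subst_atom_eq_iff \<mu>_def)
  have "unifies \<mu> ?E"
    unfolding unifies_def E by (auto simp: subst_inst intro!: \<mu>[symmetric])
  moreover have "\<exists>\<rho>. \<forall>x. \<tau> x = subst_tm \<rho> (\<mu> x)" if u: "unifies \<tau> ?E" for \<tau>
  proof (intro exI allI)
    fix x
    have "subst_atom \<tau> b = inst \<sigma> b" if "b \<in> set bs" for b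
      using u that unfolding unifies_def E by (auto simp: subst_inst)
    then show "\<tau> x = subst_tm \<tau> (\<mu> x)"
      by (auto simp: \<mu>_def subst_atom_eq_iff)
  qed
  ultimately have "is_mgu \<mu> ?E" by (simp add: is_mgu_def)
  then show ?thesis using \<mu>[OF assms] by (auto simp: consequence_def)
qed

lemma is_fact_ground_atom: "length cs = arity A \<Longrightarrow> is_fact (ground_atom A cs)"
  by (auto simp: is_fact_def)

section \<open>Proof trees and supporting rules\<close>

definition derivable ::
  "('p, 'f, 'v) drule set \<Rightarrow> ('p, 'f, 'v) atom set \<Rightarrow> ('p, 'f, 'v) atom \<Rightarrow> bool" where
  "derivable P \<A> g \<longleftrightarrow> (\<exists>t. is_proof P \<A> t \<and> root t = g)"

text \<open>A derivable fact is relevant iff it occurs in some proof of a fact from \<open>\<R>\<close>.\<close>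

inductive relevant ::
  "('p, 'f, 'v) drule set \<Rightarrow> ('p, 'f, 'v) atom set \<Rightarrow> ('p, 'f, 'v) atom set \<Rightarrow>
    ('p, 'f, 'v) atom \<Rightarrow> bool"
  for P \<A> \<R> where
  base: "g \<in> \<R> \<Longrightarrow> relevant P \<A> \<R> g"
| step: "relevant P \<A> \<R> g \<Longrightarrow> is_fact g \<Longrightarrow> r \<in> P \<Longrightarrow> consequence g r gs \<Longrightarrow>
    \<forall>g'\<in>set gs. derivable P \<A> g' \<Longrightarrow> g' \<in> set gs \<Longrightarrow> relevant P \<A> \<R> g'"

lemma derivable_fact: "g \<in> \<A> \<Longrightarrow> is_fact g \<Longrightarrow> derivable P \<A> g"
  unfolding derivable_def by (metis is_proof.leaf ptree.sel(1))

lemma extend_proofs: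
  assumes "is_fact g" "r \<in> P" "consequence g r (map root ts)" "ts \<noteq> []"
    and "\<forall>t\<in>set ts. is_proof P \<A> t"
  shows "is_proof P \<A> (Node g (map (Pair r) ts))"
  using assms by (intro is_proof.inner[where r = r]) (auto simp: o_def)

text \<open>Serves to graft a given proof \<open>t\<close> of one premise into a proof of the
  conclusion: the other premises receive chosen proofs, and \<open>t\<close> is used wherever its
  own root fact occurs.\<close>

lemma derivable_proofs:
  assumes "\<forall>g\<in>set gs. derivable P \<A> g" "is_proof P \<A> t" "root t \<in> set gs"
  obtains ts where "map root ts = gs" "\<forall>t\<in>set ts. is_proof P \<A> t" "t \<in> set ts"
proof -
  define f where
    "f g = (if g = root t then t else SOME t'. is_proof P \<A> t' \<and> root t' = g)" for g
  have f: "is_proof P \<A> (f g) \<and> root (f g) = g" if "g \<in> set gs" for g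
  proof (cases "g = root t")
    case False
    have "\<exists>t'. is_proof P \<A> t' \<and> root t' = g" using assms(1) that by (auto simp: derivable_def)
    from someI_ex[OF this] show ?thesis using False by (simp add: f_def)
  qed (use assms(2) in \<open>simp add: f_def\<close>)
  show thesis
  proof
    show "map root (map f gs) = gs" using f by (simp add: map_idI)
    show "\<forall>t\<in>set (map f gs). is_proof P \<A> t" using f by simp
    have "t = f (root t)" by (simp add: f_def)
    then show "t \<in> set (map f gs)" using assms(3) by simp
  qed
qed

text \<open>A node without children is a leaf and has no edge to carry the rule; hence the nonempty
  list of premises.\<close>

lemma derivable_consequence:
  assumes "is_fact g" "r \<in> P" "consequence g r gs" "gs \<noteq> []" "\<forall>g'\<in>set gs. derivable P \<A> g'"
  obtains t where "is_proof P \<A> t" "root t = g" "r \<in> proof_rules t"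
proof -
  obtain t0 where "is_proof P \<A> t0" "root t0 \<in> set gs"
    using assms(4,5) by (metis derivable_def list.set_sel(1))
  then obtain ts where ts: "map root ts = gs" "\<forall>t\<in>set ts. is_proof P \<A> t" "t0 \<in> set ts"
    using derivable_proofs[OF assms(5)] by metis
  then have "is_proof P \<A> (Node g (map (Pair r) ts))"
    using assms by (intro extend_proofs) auto
  moreover have "r \<in> proof_rules (Node g (map (Pair r) ts))" using ts(3) by auto
  ultimately show thesis using that by (metis ptree.sel(1))
qed

text \<open>Induction along relevance: a proof \<open>t\<close> of the premise \<open>g'\<close> is
  completed by proofs of the other premises to a proof of the relevant fact \<open>g\<close>. The
  induction hypothesis covers the rules of the larger proof, and these include those of
  \<open>t\<close>.\<close>

lemma relevant_proof_rules:
  assumes "relevant P \<A> \<R> g" "is_proof P \<A> t" "root t = g"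
  shows "proof_rules t \<subseteq> (\<Union>g\<in>\<R>. support_fact P \<A> g)"
  using assms
proof (induction arbitrary: t rule: relevant.induct)
  case (base g)
  then show ?case by (auto simp: support_fact_def)
next
  case (step g r gs g')
  then obtain ts where ts: "map root ts = gs" "\<forall>t\<in>set ts. is_proof P \<A> t" "t \<in> set ts"
    using derivable_proofs[OF step.hyps(5)] by metis
  then have "is_proof P \<A> (Node g (map (Pair r) ts))"
    using step.hyps by (intro extend_proofs) auto
  then have "proof_rules (Node g (map (Pair r) ts)) \<subseteq> (\<Union>g\<in>\<R>. support_fact P \<A> g)"
    by (intro step.IH) simp_all
  moreover have "proof_rules t \<subseteq> proof_rules (Node g (map (Pair r) ts))" using ts(3) by auto
  ultimately show ?case by blast
qed

section \<open>The product model\<close>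

text \<open>The maps \<open>h\<close> and \<open>k\<close> are the projections of the domain \<open>UNIV\<close>, and \<open>s d c\<close> is an element
  representing the pair \<open>(d, c)\<close>. A pair may have several representatives; this is harmless
  because equality is an ordinary predicate.\<close>

locale product_model =
  fixes T :: "('p, 'f, 'v) rule set"
    and \<theta> :: "'v \<rightharpoonup> 'f"
    and \<A> \<R> :: "('p, 'f, 'v) atom set"
    and I :: "('p, 'f, 'u) interp"
    and C :: "'f set"
    and c0 :: 'f
    and h :: "'u \<Rightarrow> 'u"
    and k :: "'u \<Rightarrow> 'f"
    and s :: "'u \<Rightarrow> 'f \<Rightarrow> 'u"
  assumes rules: "r \<in> T \<Longrightarrow> is_rule r"
    and constant_free: "r \<in> T \<Longrightarrow> constant_free r"
    and dom_\<theta>: "dom \<theta> = evars_tbox T"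
    and ran_\<theta>: "ran \<theta> \<subseteq> C"
    and Verum: "ground_atom Verum [] \<in> \<A>"
    and Falsum: "ground_atom Falsum [] \<in> \<R>"
    and I: "is_interp I"
    and c0: "c0 \<in> C"
    and h: "h u \<in> dom_of I"
    and k: "k u \<in> C"
    and h_s: "d \<in> dom_of I \<Longrightarrow> c \<in> C \<Longrightarrow> h (s d c) = d"
    and k_s: "d \<in> dom_of I \<Longrightarrow> c \<in> C \<Longrightarrow> k (s d c) = c"
begin

abbreviation "P \<equiv> program T (\<theta>, \<A>, \<R>)"

text \<open>Function values receive the tag \<open>c0\<close>. Rules of \<open>T\<close> contain
  neither constants nor functions, so this default matters only for the terms of the sentence
  \<phi>.\<close>

definition J :: "('p, 'f, 'u) interp" where
  "J = Interp UNIV (\<lambda>f us. s (fun_of I f (map h us)) c0)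
    (\<lambda>B us. derivable P \<A> (ground_atom B (map k us)) \<and>
      (relevant P \<A> \<R> (ground_atom B (map k us)) \<longrightarrow> rel_of I B (map h us)))"

lemma dom_J [simp]: "dom_of J = UNIV"
  by (simp add: J_def)

lemma rel_J:
  "rel_of J B us \<longleftrightarrow> derivable P \<A> (ground_atom B (map k us)) \<and>
    (relevant P \<A> \<R> (ground_atom B (map k us)) \<longrightarrow> rel_of I B (map h us))"
  by (simp add: J_def)

text \<open>Truth is a leaf and holds in \<open>I\<close>; falsity is relevant as a member of
  \<open>\<R>\<close>, so it could hold in \<open>J\<close> only if it held in
  \<open>I\<close>.\<close>

lemma is_interp_J: "is_interp J"
proof -
  have "is_fact (ground_atom Verum [])" by (simp add: is_fact_ground_atom)
  then have "derivable P \<A> (ground_atom Verum [])" using Verum derivable_fact by blast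
  moreover have "relevant P \<A> \<R> (ground_atom Falsum [])" using Falsum by (rule relevant.base)
  ultimately show ?thesis using I by (auto simp: is_interp_def rel_J)
qed

lemma fun_J:
  "h (fun_of J f us) = fun_of I f (map h us)" "k (fun_of J f us) = c0"
proof -
  have "set (map h us) \<subseteq> dom_of I" using h by auto
  then have "fun_of I f (map h us) \<in> dom_of I" using I by (simp add: is_interp_def)
  then show "h (fun_of J f us) = fun_of I f (map h us)" "k (fun_of J f us) = c0"
    using h_s k_s c0 by (simp_all add: J_def)
qed

lemma h_eval: "h (eval_tm J e t) = eval_tm I (\<lambda>x. h (e x)) t"
  by (induction t) (simp_all add: fun_J o_def cong: map_cong)

lemma k_eval: "(\<And>x. k (e x) = c0) \<Longrightarrow> k (eval_tm J e t) = c0"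
  by (cases t) (simp_all add: fun_J)

lemma map_h_eval: "map h (map (eval_tm J e) ts) = map (eval_tm I (\<lambda>x. h (e x))) ts"
  by (simp add: h_eval)

lemma map_k_eval:
  "(\<And>x. k (e x) = c0) \<Longrightarrow> map k (map (eval_tm J e) ts) = replicate (length ts) c0"
  by (rule nth_equalityI) (simp_all add: k_eval)

lemma lift_assignment:
  assumes "range e \<subseteq> dom_of I" "range c \<subseteq> C"
  obtains e' where "\<And>x. h (e' x) = e x" "\<And>x. k (e' x) = c x"
proof -
  have "e x \<in> dom_of I" "c x \<in> C" for x using assms by auto
  then show thesis using that[of "\<lambda>x. s (e x) (c x)"] by (simp add: h_s k_s)
qed

text \<open>The arguments of a rule atom are variables, since rules of \<open>T\<close> have neither
  functions nor constants. Their tags are thus those of the assignment, which makes the fact tested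
  by \<open>J\<close> an instance of the atom.\<close>

lemma holds_J:
  assumes "r \<in> T" "a \<in> atoms_rule r"
  shows "holds J e a \<longleftrightarrow> derivable P \<A> (inst (\<lambda>x. k (e x)) a) \<and>
    (relevant P \<A> \<R> (inst (\<lambda>x. k (e x)) a) \<longrightarrow> holds I (\<lambda>x. h (e x)) a)"
    and "is_fact (inst \<sigma> a)"
proof -
  have flat: "flat_atom a" using rules[OF assms(1)] assms(2) by (simp add: is_rule_def)
  have var: "\<exists>x. t = Var x" if "t \<in> set (args_of a)" for t
    using flat constant_free[OF assms(1)] assms(2) that
    by (auto simp: flat_atom_def constant_free_def)
  have "Const (k (eval_tm J e t)) = subst_tm (\<lambda>x. Const (k (e x))) t"
    if "t \<in> set (args_of a)" for t
    using var[OF that] by auto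
  then have "ground_atom (pred_of a) (map k (map (eval_tm J e) (args_of a))) = inst (\<lambda>x. k (e x)) a"
    by (simp add: ground_atom_def subst_atom_def)
  then show "holds J e a \<longleftrightarrow> derivable P \<A> (inst (\<lambda>x. k (e x)) a) \<and>
    (relevant P \<A> \<R> (inst (\<lambda>x. k (e x)) a) \<longrightarrow> holds I (\<lambda>x. h (e x)) a)"
    by (simp only: holds_def rel_J map_h_eval)
  have "\<exists>c. subst_tm (\<lambda>x. Const (\<sigma> x)) t = Const c" if "t \<in> set (args_of a)" for t
    using var[OF that] by auto
  then obtain c where "\<And>t. t \<in> set (args_of a) \<Longrightarrow> subst_tm (\<lambda>x. Const (\<sigma> x)) t = Const (c t)"
    by metis
  then have "inst \<sigma> a = ground_atom (pred_of a) (map c (args_of a))"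
    by (simp add: subst_atom_def ground_atom_def)
  then show "is_fact (inst \<sigma> a)"
    using flat by (simp add: is_fact_ground_atom flat_atom_def)
qed

text \<open>Here the module enters: a proof of a relevant fact that ends with the rule puts this
  rule into the support, and relevance passes from the conclusion to all premises.\<close>

lemma program_step:
  assumes r: "r \<in> T" and body: "\<forall>b\<in>set (body r). derivable P \<A> (inst \<sigma> b)"
    and H: "DRule (body r) H \<in> corresponding \<theta> r" "is_fact (inst \<sigma> H)"
      "vars_atom H \<subseteq> (\<Union>b\<in>set (body r). vars_atom b)"
  shows "derivable P \<A> (inst \<sigma> H)"
    and "relevant P \<A> \<R> (inst \<sigma> H) \<Longrightarrow>
      r \<in> module T (\<theta>, \<A>, \<R>) \<and> (\<forall>b\<in>set (body r). relevant P \<A> \<R> (inst \<sigma> b))"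
proof -
  have P: "DRule (body r) H \<in> P" using r H(1) by (auto simp: program_def)
  have cons: "consequence (inst \<sigma> H) (DRule (body r) H) (map (inst \<sigma>) (body r))"
    using H(3) by (rule consequence_inst)
  have ne: "map (inst \<sigma>) (body r) \<noteq> []" using rules[OF r] by (simp add: is_rule_def)
  have der: "\<forall>g\<in>set (map (inst \<sigma>) (body r)). derivable P \<A> g" using body by simp
  obtain t where t: "is_proof P \<A> t" "root t = inst \<sigma> H" "DRule (body r) H \<in> proof_rules t"
    using derivable_consequence[OF H(2) P cons ne der] .
  then show "derivable P \<A> (inst \<sigma> H)" by (auto simp: derivable_def)
  assume rel: "relevant P \<A> \<R> (inst \<sigma> H)"
  have "DRule (body r) H \<in> support T (\<theta>, \<A>, \<R>)"
    using relevant_proof_rules[OF rel t(1,2)] t(3) by (auto simp: support_def)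
  moreover have "relevant P \<A> \<R> (inst \<sigma> b)" if "b \<in> set (body r)" for b
    using relevant.step[OF rel H(2) P cons der] that by simp
  ultimately show "r \<in> module T (\<theta>, \<A>, \<R>) \<and> (\<forall>b\<in>set (body r). relevant P \<A> \<R> (inst \<sigma> b))"
    using r H(1) by (auto simp: module_def)
qed

text \<open>As \<sigma> extends \<theta> on the existential variables, instantiating the program's
  head \<open>?H\<close> and instantiating \<open>a\<close> directly give the same fact. Safety
  places the remaining variables in the body.\<close>

lemma head_step:
  assumes r: "r \<in> T" and body: "\<forall>b\<in>set (body r). derivable P \<A> (inst \<sigma> b)"
    and a: "\<psi> \<in> set (heads r)" "a \<in> set \<psi>"
    and \<sigma>: "\<forall>y\<in>set (evars r). \<theta> y = Some (\<sigma> y)"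
  shows "derivable P \<A> (inst \<sigma> a)"
    and "relevant P \<A> \<R> (inst \<sigma> a) \<Longrightarrow>
      r \<in> module T (\<theta>, \<A>, \<R>) \<and> (\<forall>b\<in>set (body r). relevant P \<A> \<R> (inst \<sigma> b))"
proof -
  let ?\<theta> = "subst_of (\<theta> |` set (evars r))"
  let ?H = "subst_atom ?\<theta> a"
  have eq: "inst \<sigma> ?H = inst \<sigma> a"
    using \<sigma> by (auto simp: subst_atom_subst_atom subst_atom_eq_iff subst_of_def restrict_map_def)
  have "a \<in> atoms_rule r" using a by (auto simp: atoms_rule_def)
  then have fact: "is_fact (inst \<sigma> ?H)" using holds_J(2)[OF r] eq by simp
  have corr: "DRule (body r) ?H \<in> corresponding \<theta> r"
    using a by (auto simp: corresponding_def)
  have "vars_atom a \<subseteq> set (uvars r) \<union> set (evars r)"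
    "vars_atom a \<inter> set (uvars r) \<subseteq> (\<Union>b\<in>set (body r). vars_atom b)"
    using rules[OF r] a by (auto simp: is_rule_def)
  moreover have "vars_atom ?H \<subseteq> vars_atom a - set (evars r)"
    using \<sigma> by (auto simp: vars_subst_atom subst_of_def restrict_map_def split: if_splits)
  ultimately have vars: "vars_atom ?H \<subseteq> (\<Union>b\<in>set (body r). vars_atom b)" by blast
  show "derivable P \<A> (inst \<sigma> a)"
    "relevant P \<A> \<R> (inst \<sigma> a) \<Longrightarrow>
      r \<in> module T (\<theta>, \<A>, \<R>) \<and> (\<forall>b\<in>set (body r). relevant P \<A> \<R> (inst \<sigma> b))"
    using program_step[OF r body corr fact vars] eq by simp_all
qed

text \<open>All head facts are derivable in any case, so only the relevant ones impose a condition
  on \<open>I\<close>. If one is relevant, the rule is in the module and its body holds in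
  \<open>I\<close>, so \<open>I\<close> supplies a disjunct. If none is and the head is nonempty,
  any disjunct will do.\<close>

lemma J_satisfies_rule:
  assumes r: "r \<in> T"
    and sat: "r \<in> module T (\<theta>, \<A>, \<R>) \<Longrightarrow> satisfies I (fm_of_rule r)"
  shows "satisfies J (fm_of_rule r)"
  unfolding satisfies_rule[OF is_interp_J]
proof (intro allI impI)
  fix e :: "'v \<Rightarrow> 'u"
  assume body: "\<forall>a\<in>set (body r). holds J e a"
  have rule: "is_rule r" using rules r .
  have bodyT: "a \<in> atoms_rule r" if "a \<in> set (body r)" for a
    using that by (simp add: atoms_rule_def)
  have headT: "a \<in> atoms_rule r" if "\<psi> \<in> set (heads r)" "a \<in> set \<psi>" for a \<psi>
    using that by (auto simp: atoms_rule_def)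
  have disj: "set (uvars r) \<inter> set (evars r) = {}"
    and bodyV: "\<And>a. a \<in> set (body r) \<Longrightarrow> vars_atom a \<subseteq> set (uvars r)"
    using rule by (auto simp: is_rule_def)
  have der0: "derivable P \<A> (inst (\<lambda>x. k (e x)) b)" if "b \<in> set (body r)" for b
    using body holds_J(1)[OF r bodyT[OF that], of e] that by blast
  have bodyI: "holds I (\<lambda>x. h (e x)) b"
    if "b \<in> set (body r)" "relevant P \<A> \<R> (inst (\<lambda>x. k (e x)) b)" for b
    using body holds_J(1)[OF r bodyT[OF that(1)], of e] that by blast
  have \<theta>: "\<theta> y = Some (the (\<theta> y))" "the (\<theta> y) \<in> C" if "y \<in> set (evars r)" for y
  proof -
    have "y \<in> dom \<theta>" using that r by (auto simp: dom_\<theta> evars_tbox_def)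
    then show "\<theta> y = Some (the (\<theta> y))" "the (\<theta> y) \<in> C" using ran_\<theta> by (auto intro: ranI)
  qed
  \<comment> \<open>The tags of the assignment to be built: \<theta> prescribes them at existential
    variables, elsewhere they come from \<open>e\<close>.\<close>
  define \<sigma> where "\<sigma> x = (if x \<in> set (evars r) then the (\<theta> x) else k (e x))" for x
  have \<sigma>C: "range \<sigma> \<subseteq> C" using \<theta> k by (auto simp: \<sigma>_def)
  have \<sigma>_evars: "\<forall>y\<in>set (evars r). \<theta> y = Some (\<sigma> y)" using \<theta> by (simp add: \<sigma>_def)
  have inst_body: "inst \<sigma> b = inst (\<lambda>x. k (e x)) b" if "b \<in> set (body r)" for b
    using bodyV[OF that] disj by (auto simp: subst_atom_eq_iff \<sigma>_def)
  have der: "\<forall>b\<in>set (body r). derivable P \<A> (inst \<sigma> b)" using der0 inst_body by simp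
  let ?rel = "relevant P \<A> \<R>"
  \<comment> \<open>Off the existential variables \<open>e\<close> itself is kept and not rebuilt
    from its components, because a pair may have several representatives.\<close>
  have extend: "\<exists>e'. (\<forall>x. x \<notin> set (evars r) \<longrightarrow> e' x = e x) \<and> (\<forall>x. k (e' x) = \<sigma> x) \<and>
      (\<forall>x. h (e' x) = d x)"
    if d: "range d \<subseteq> dom_of I" "\<forall>x. x \<notin> set (evars r) \<longrightarrow> d x = h (e x)" for d
  proof -
    obtain e1 where "\<And>x. h (e1 x) = d x" "\<And>x. k (e1 x) = \<sigma> x"
      using lift_assignment[OF d(1) \<sigma>C] by blast
    then show ?thesis
      using d(2) by (intro exI[of _ "\<lambda>x. if x \<in> set (evars r) then e1 x else e x"])
        (auto simp: \<sigma>_def)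
  qed
  have use_sat: "\<exists>d. range d \<subseteq> dom_of I \<and> (\<forall>x. x \<notin> set (evars r) \<longrightarrow> d x = h (e x)) \<and>
      (\<exists>\<psi>\<in>set (heads r). \<forall>a\<in>set \<psi>. holds I d a)"
    if "r \<in> module T (\<theta>, \<A>, \<R>)" "\<forall>b\<in>set (body r). ?rel (inst \<sigma> b)"
  proof -
    have "range (\<lambda>x. h (e x)) \<subseteq> dom_of I" using h by auto
    moreover have "\<forall>b\<in>set (body r). holds I (\<lambda>x. h (e x)) b"
      using bodyI that(2) inst_body by simp
    ultimately show ?thesis
      using sat[OF that(1)] unfolding satisfies_rule[OF I] by blast
  qed
  have "\<exists>d. range d \<subseteq> dom_of I \<and> (\<forall>x. x \<notin> set (evars r) \<longrightarrow> d x = h (e x)) \<and>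
      (\<exists>\<psi>\<in>set (heads r). \<forall>a\<in>set \<psi>. ?rel (inst \<sigma> a) \<longrightarrow> holds I d a)"
  proof (cases "\<exists>\<psi>\<in>set (heads r). \<exists>a\<in>set \<psi>. ?rel (inst \<sigma> a)")
    case True
    then obtain \<psi> a where "\<psi> \<in> set (heads r)" "a \<in> set \<psi>" "?rel (inst \<sigma> a)" by blast
    \<comment> \<open>The disjunct true in \<open>I\<close> may differ from the one with the
      relevant atom; all of its atoms hold, relevant or not.\<close>
    then show ?thesis using head_step(2)[OF r der _ _ \<sigma>_evars] use_sat by blast
  next
    case False
    show ?thesis
    proof (cases "heads r = []")
      case True
      \<comment> \<open>The datalog rule for an empty head derives falsity, which is relevant. So
        the rule is in the module, and \<open>I\<close> would have to satisfy an empty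
        disjunction.\<close>
      let ?F = "Atom Falsum []"
      have F: "inst \<sigma> ?F = ground_atom Falsum []"
        by (simp add: subst_atom_def ground_atom_def)
      have "?rel (inst \<sigma> ?F)" unfolding F using Falsum by (rule relevant.base)
      moreover have "DRule (body r) ?F \<in> corresponding \<theta> r"
        using True by (simp add: corresponding_def)
      moreover have "is_fact (inst \<sigma> ?F)" unfolding F by (simp add: is_fact_ground_atom)
      moreover have "vars_atom ?F \<subseteq> (\<Union>b\<in>set (body r). vars_atom b)"
        by (simp add: vars_atom_def)
      ultimately have "r \<in> module T (\<theta>, \<A>, \<R>)" "\<forall>b\<in>set (body r). ?rel (inst \<sigma> b)"
        using program_step(2)[OF r der] by blast+
      then show ?thesis using use_sat by blast
    next
      case ne: False
      show ?thesis
        using False ne h by (intro exI[of _ "\<lambda>x. h (e x)"]) (auto simp: neq_Nil_conv)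
    qed
  qed
  then obtain d \<psi> where d: "range d \<subseteq> dom_of I" "\<forall>x. x \<notin> set (evars r) \<longrightarrow> d x = h (e x)"
    and \<psi>: "\<psi> \<in> set (heads r)" "\<forall>a\<in>set \<psi>. ?rel (inst \<sigma> a) \<longrightarrow> holds I d a" by blast
  obtain e' where e': "\<forall>x. x \<notin> set (evars r) \<longrightarrow> e' x = e x" "\<forall>x. k (e' x) = \<sigma> x"
    "\<forall>x. h (e' x) = d x"
    using extend[OF d] by blast
  have "holds J e' a" if "a \<in> set \<psi>" for a
    using holds_J(1)[OF r headT[OF \<psi>(1) that], of e'] head_step(1)[OF r der \<psi>(1) that \<sigma>_evars]
      \<psi>(2) that e'(2,3) by simp
  then show "\<exists>e'. range e' \<subseteq> dom_of J \<and> (\<forall>x. x \<notin> set (evars r) \<longrightarrow> e' x = e x) \<and>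
      (\<exists>\<psi>\<in>set (heads r). \<forall>a\<in>set \<psi>. holds J e' a)"
    using e'(1) \<psi>(1) by (intro exI[of _ e']) auto
qed

text \<open>Members of \<open>\<A>\<close> are derivable as leaves and members of
  \<open>\<R>\<close> are relevant, which gives the two directions. Function terms are allowed here,
  as they may occur in \<phi>.\<close>

lemma holds_J_facts:
  fixes a :: "('p, 'f, 'v) atom" and e :: "'v \<Rightarrow> 'u"
  defines "g \<equiv> ground_atom (pred_of a) (map k (map (eval_tm J e) (args_of a)))"
  assumes "is_fact g"
  shows "g \<in> \<A> \<Longrightarrow> holds I (\<lambda>x. h (e x)) a \<Longrightarrow> holds J e a"
    and "g \<in> \<R> \<Longrightarrow> holds J e a \<Longrightarrow> holds I (\<lambda>x. h (e x)) a"
proof -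
  have "holds J e a \<longleftrightarrow>
      derivable P \<A> g \<and> (relevant P \<A> \<R> g \<longrightarrow> holds I (\<lambda>x. h (e x)) a)"
    unfolding holds_def rel_J map_h_eval g_def ..
  moreover have "g \<in> \<A> \<Longrightarrow> derivable P \<A> g" using assms(2) derivable_fact by blast
  moreover have "g \<in> \<R> \<Longrightarrow> relevant P \<A> \<R> g" by (rule relevant.base)
  ultimately show "g \<in> \<A> \<Longrightarrow> holds I (\<lambda>x. h (e x)) a \<Longrightarrow> holds J e a"
    "g \<in> \<R> \<Longrightarrow> holds J e a \<Longrightarrow> holds I (\<lambda>x. h (e x)) a" by simp_all
qed

text \<open>Quantifiers agree because \<open>h\<close> maps the domain of \<open>J\<close> onto that
  of \<open>I\<close>; equality is an ordinary predicate, so identifications made by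
  \<open>h\<close> do no harm.\<close>

lemma eval_fm_J:
  assumes "\<And>a e. a \<in> atoms_fm F \<Longrightarrow> holds J e a \<longleftrightarrow> holds I (\<lambda>x. h (e x)) a"
  shows "eval_fm J e F \<longleftrightarrow> eval_fm I (\<lambda>x. h (e x)) F"
proof -
  have upd: "(\<lambda>y. h ((e(x := u)) y)) = (\<lambda>y. h (e y))(x := h u)"
    for e :: "'w \<Rightarrow> 'u" and x u by auto
  have range_h: "range h = dom_of I"
  proof
    show "range h \<subseteq> dom_of I" using h by auto
    show "dom_of I \<subseteq> range h" using h_s[OF _ c0] by (metis rangeI subsetI)
  qed
  from assms show ?thesis
  proof (induction F arbitrary: e)
    case (FAtom a)
    from FAtom[of a e] show ?case by (simp add: holds_def)
  next
    case (All x F)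
    then have IH: "eval_fm J e F \<longleftrightarrow> eval_fm I (\<lambda>x. h (e x)) F" for e by simp
    have "eval_fm J e (All x F) \<longleftrightarrow> (\<forall>d\<in>range h. eval_fm I ((\<lambda>y. h (e y))(x := d)) F)"
      by (simp add: IH upd del: fun_upd_apply)
    then show ?case by (simp add: range_h)
  next
    case (Ex x F)
    then have IH: "eval_fm J e F \<longleftrightarrow> eval_fm I (\<lambda>x. h (e x)) F" for e by simp
    have "eval_fm J e (Ex x F) \<longleftrightarrow> (\<exists>d\<in>range h. eval_fm I ((\<lambda>y. h (e y))(x := d)) F)"
      by (simp add: IH upd del: fun_upd_apply)
    then show ?case by (simp add: range_h)
  qed auto
qed

end

text \<open>The product of a subset of an infinite type with a finite set is no larger than the
  type, which therefore maps onto \<open>D \<times> C\<close>. The components of this surjection are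
  \<open>h\<close> and \<open>k\<close>, and \<open>s\<close> chooses preimages.\<close>

lemma product_projections:
  fixes D :: "'u set" and C :: "'f set"
  assumes "infinite (UNIV :: 'u set)" "D \<noteq> {}" "finite C" "C \<noteq> {}"
  obtains h :: "'u \<Rightarrow> 'u" and k :: "'u \<Rightarrow> 'f" and s where
    "\<And>u. h u \<in> D" "\<And>u. k u \<in> C"
    "\<And>d c. d \<in> D \<Longrightarrow> c \<in> C \<Longrightarrow> h (s d c) = d" "\<And>d c. d \<in> D \<Longrightarrow> c \<in> C \<Longrightarrow> k (s d c) = c"
proof -
  have "(card_of C, card_of (UNIV :: 'u set)) \<in> ordLeq"
    using assms(1,3) by (meson finite_iff_ordLess_natLeq infinite_iff_natLeq_ordLeq ordLess_imp_ordLeq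
        ordLess_ordLeq_trans)
  moreover have "(card_of D, card_of (UNIV :: 'u set)) \<in> ordLeq" by (simp add: card_of_mono1)
  ultimately have "(card_of (D \<times> C), card_of (UNIV :: 'u set)) \<in> ordLeq"
    using assms(1)
    by (intro card_of_Times_ordLeq_infinite_Field) (simp_all add: Field_card_of card_of_card_order_on)
  then obtain p :: "'u \<Rightarrow> 'u \<times> 'f" where p: "range p = D \<times> C"
    using card_of_ordLeq2[of "D \<times> C" "UNIV :: 'u set"] assms(2,4) by auto
  define s where "s d c = (SOME u. p u = (d, c))" for d c
  have s: "p (s d c) = (d, c)" if "d \<in> D" "c \<in> C" for d c
  proof -
    have "(d, c) \<in> range p" using p that by simp
    then have "\<exists>u. p u = (d, c)" by (metis imageE)
    then show ?thesis unfolding s_def by (rule someI_ex)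
  qed
  have "p u \<in> D \<times> C" for u using p by auto
  then show thesis using that[of "fst \<circ> p" "snd \<circ> p" s] s by (simp add: mem_Times_iff)
qed

text \<open>The hypothesis \<open>transfer\<close> isolates what depends on the form of \<phi>.
  Program and module are those of \<open>T\<close>, whereas \<open>J\<close> is shown to satisfy the
  rules of \<open>T'\<close>.\<close>

lemma justification_subset_module:
  fixes T T' :: "('p, 'f, 'v) rule set" and F :: "('p, 'f, 'v) fm"
  assumes infinite_type: "infinite (UNIV :: 'u set)"
    and tbox: "is_tbox T" "\<forall>r\<in>T. constant_free r"
    and justification: "is_justification TYPE('u) T F T'"
    and setting: "dom \<theta> = evars_tbox T" "ran \<theta> \<subseteq> C" "finite C" "c0 \<in> C"
      "ground_atom Verum [] \<in> \<A>" "ground_atom Falsum [] \<in> \<R>"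
    and transfer: "\<And>(I :: ('p, 'f, 'u) interp) h k s.
      product_model T \<theta> \<A> \<R> I C c0 h k s \<Longrightarrow>
      satisfies (product_model.J T \<theta> \<A> \<R> I c0 h k s) F \<Longrightarrow> satisfies I F"
  shows "T' \<subseteq> module T (\<theta>, \<A>, \<R>)"
proof (rule ccontr)
  assume "\<not> T' \<subseteq> module T (\<theta>, \<A>, \<R>)"
  then have "T' \<inter> module T (\<theta>, \<A>, \<R>) \<subset> T'" by blast
  then have "\<not> entails TYPE('u) (fm_of_rule ` (T' \<inter> module T (\<theta>, \<A>, \<R>))) F"
    using justification by (simp add: is_justification_def)
  then obtain I :: "('p, 'f, 'u) interp" where
    countermodel: "is_interp I" "\<not> satisfies I F"
    and sat: "\<And>r. r \<in> T' \<Longrightarrow> r \<in> module T (\<theta>, \<A>, \<R>) \<Longrightarrow> satisfies I (fm_of_rule r)"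
    by (auto simp: entails_def)
  have "dom_of I \<noteq> {}" "C \<noteq> {}" using countermodel setting(4) by (auto simp: is_interp_def)
  then obtain h k s where
    "\<And>u :: 'u. h u \<in> dom_of I" "\<And>u :: 'u. k u \<in> C"
    "\<And>d c. d \<in> dom_of I \<Longrightarrow> c \<in> C \<Longrightarrow> h (s d c) = d"
    "\<And>d c. d \<in> dom_of I \<Longrightarrow> c \<in> C \<Longrightarrow> k (s d c) = c"
    using product_projections[OF infinite_type _ setting(3)] by metis
  then interpret product_model T \<theta> \<A> \<R> I C c0 h k s
    using tbox setting countermodel by unfold_locales (auto simp: is_tbox_def)
  have "T' \<subseteq> T" "entails TYPE('u) (fm_of_rule ` T') F"
    using justification by (simp_all add: is_justification_def)
  moreover from this have "satisfies J (fm_of_rule r)" if "r \<in> T'" for r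
    using that sat by (intro J_satisfies_rule) auto
  ultimately have "satisfies J F" using is_interp_J by (auto simp: entails_def)
  then show False using transfer[OF product_model_axioms] countermodel(2) by blast
qed

section \<open>Transfer of countermodels\<close>

lemma atoms_fm_lists:
  "(\<Union>F\<in>set Fs. atoms_fm F) \<subseteq> atoms_fm (conj_list Fs)"
  "(\<Union>F\<in>set Fs. atoms_fm F) \<subseteq> atoms_fm (disj_list Fs)"
proof -
  show "(\<Union>F\<in>set Fs. atoms_fm F) \<subseteq> atoms_fm (conj_list Fs)"
    by (induction Fs rule: conj_list.induct) auto
  show "(\<Union>F\<in>set Fs. atoms_fm F) \<subseteq> atoms_fm (disj_list Fs)"
    by (induction Fs rule: disj_list.induct) auto
qed

lemma atoms_rule_subset: "atoms_rule r \<subseteq> atoms_fm (fm_of_rule r)"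
proof -
  have all: "atoms_fm (foldr All xs F) = atoms_fm F" for xs and F :: "('a, 'b, 'c) fm"
    by (induction xs) simp_all
  have ex: "atoms_fm (foldr Ex xs F) = atoms_fm F" for xs and F :: "('a, 'b, 'c) fm"
    by (induction xs) simp_all
  have conj: "a \<in> atoms_fm (conj_list (map FAtom as))" if "a \<in> set as"
    for a :: "('a, 'b, 'c) atom" and as
    using that atoms_fm_lists(1)[of "map FAtom as"] by auto
  have "a \<in> atoms_fm (disj_list (map (\<lambda>\<psi>. conj_list (map FAtom \<psi>)) (heads r)))"
    if "\<psi> \<in> set (heads r)" "a \<in> set \<psi>" for \<psi> a
    using that conj atoms_fm_lists(2)[of "map (\<lambda>\<psi>. conj_list (map FAtom \<psi>)) (heads r)"] by auto
  then show ?thesis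
    by (auto simp: fm_of_rule_def all ex atoms_rule_def conj)
qed

lemma pred_of_rule_in_sig: "a \<in> atoms_rule r \<Longrightarrow> pred_of a \<in> sig_fm (fm_of_rule r)"
  using atoms_rule_subset[of r] by (auto simp: sig_fm_def)

section \<open>From \<open>J\<close> back to \<open>I\<close>: sentences, rules, atomic
  implications\<close>

context product_model
begin

text \<open>With a single constant there is one fact per predicate, and for predicates of
  \<open>\<Sigma>\<close> it lies in both \<open>\<A>\<close> and \<open>\<R>\<close>. So
  \<open>J\<close> and \<open>I\<close> agree on the atoms of \<open>F\<close>, whatever its
  shape.\<close>

lemma transfer_formula:
  fixes F :: "('p, 'f, 'v) fm"
  assumes "C = {c0}" "sentence F" "sig_fm F \<subseteq> \<Sigma>" "\<A> = A0_f \<Sigma> c0" "\<R> = A0_f \<Sigma> c0"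
    and sat: "satisfies J F"
  shows "satisfies I F"
proof -
  have "holds J e a \<longleftrightarrow> holds I (\<lambda>x. h (e x)) a" if a: "a \<in> atoms_fm F" for e a
  proof -
    have "k u = c0" for u using k assms(1) by auto
    then have eq: "map k (map (eval_tm J e) (args_of a)) = replicate (arity (pred_of a)) c0"
      using assms(2) a map_k_eval[of e "args_of a"] by (auto simp: sentence_def)
    have "pred_of a \<in> \<Sigma>" using assms(3) a by (auto simp: sig_fm_def)
    then have "ground_atom (pred_of a) (replicate (arity (pred_of a)) c0) \<in> A0_f \<Sigma> c0"
      by (auto simp: A0_f_def)
    moreover have "is_fact (ground_atom (pred_of a) (replicate (arity (pred_of a)) c0))"
      by (simp add: is_fact_ground_atom)
    ultimately show ?thesis using holds_J_facts[of a e] assms(4,5) unfolding eq by metis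
  qed
  note eval = eval_fm_J[OF this]
  show ?thesis unfolding satisfies_def
  proof (intro allI impI)
    fix e :: "'v \<Rightarrow> 'u" assume "range e \<subseteq> dom_of I"
    then obtain e' where e': "\<And>x. h (e' x) = e x" "\<And>x. k (e' x) = c0"
      using lift_assignment[of e "\<lambda>_. c0"] c0 by auto
    have "eval_fm J e' F" using sat by (simp add: satisfies_def)
    then show "eval_fm I e F" using eval e' by simp
  qed
qed

text \<open>The last hypothesis covers two ways to make the head facts relevant: either all tuples of
  constants are, or no existential variable reaches a constant other than \<open>c0\<close>.\<close>

lemma transfer_rule:
  fixes r :: "('p, 'f, 'v) rule"
  assumes r: "is_rule r" "sig_fm (fm_of_rule r) \<subseteq> \<Sigma>" and \<A>: "\<A> = A0_f \<Sigma> c0"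
    and \<R>: "\<And>A cs. A \<in> \<Sigma> \<Longrightarrow> length cs = arity A \<Longrightarrow> set cs \<subseteq> C \<Longrightarrow>
      evars r = [] \<longrightarrow> set cs \<subseteq> {c0} \<Longrightarrow> ground_atom A cs \<in> \<R>"
    and sat: "satisfies J (fm_of_rule r)"
  shows "satisfies I (fm_of_rule r)"
  unfolding satisfies_rule[OF I]
proof (intro allI impI)
  fix e :: "'v \<Rightarrow> 'u"
  assume e: "range e \<subseteq> dom_of I" and body: "\<forall>a\<in>set (body r). holds I e a"
  obtain e1 where e1: "\<And>x. h (e1 x) = e x" "\<And>x. k (e1 x) = c0"
    using lift_assignment[OF e, of "\<lambda>_. c0"] c0 by auto
  have len: "length (args_of a) = arity (pred_of a)" if "a \<in> atoms_rule r" for a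
    using r(1) that by (auto simp: is_rule_def flat_atom_def)
  have sig: "pred_of a \<in> \<Sigma>" if "a \<in> atoms_rule r" for a
    using r(2) pred_of_rule_in_sig[OF that] by blast
  have fact: "is_fact (ground_atom (pred_of a) (map k (map (eval_tm J e') (args_of a))))"
    if "a \<in> atoms_rule r" for e' a
    using len[OF that] by (simp add: is_fact_ground_atom)
  have "holds J e1 a" if a: "a \<in> set (body r)" for a
  proof -
    have aT: "a \<in> atoms_rule r" using a by (simp add: atoms_rule_def)
    have "ground_atom (pred_of a) (map k (map (eval_tm J e1) (args_of a))) \<in> \<A>"
      unfolding map_k_eval[OF e1(2)] len[OF aT] using sig[OF aT] by (auto simp: \<A> A0_f_def)
    from holds_J_facts(1)[OF fact[OF aT] this] show ?thesis using body a e1(1) by simp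
  qed
  then have "\<exists>e2. (\<forall>x. x \<notin> set (evars r) \<longrightarrow> e2 x = e1 x) \<and>
      (\<exists>\<psi>\<in>set (heads r). \<forall>a\<in>set \<psi>. holds J e2 a)"
    using sat unfolding satisfies_rule[OF is_interp_J] by simp
  then obtain e2 \<psi> where e2: "\<forall>x. x \<notin> set (evars r) \<longrightarrow> e2 x = e1 x"
    and \<psi>: "\<psi> \<in> set (heads r)" "\<forall>a\<in>set \<psi>. holds J e2 a"
    by blast
  have "holds I (\<lambda>x. h (e2 x)) a" if a: "a \<in> set \<psi>" for a
  proof -
    have aT: "a \<in> atoms_rule r" using a \<psi>(1) by (auto simp: atoms_rule_def)
    have "ground_atom (pred_of a) (map k (map (eval_tm J e2) (args_of a))) \<in> \<R>"
    proof (rule \<R>)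
      \<comment> \<open>\<open>e2\<close> departs from \<open>e1\<close> at existential variables
        only, so without them every tag is still \<open>c0\<close>.\<close>
      show "evars r = [] \<longrightarrow> set (map k (map (eval_tm J e2) (args_of a))) \<subseteq> {c0}"
        using map_k_eval[of e2 "args_of a"] e2 e1(2) by auto
    qed (use sig[OF aT] len[OF aT] k in auto)
    from holds_J_facts(2)[OF fact[OF aT] this] show ?thesis using \<psi>(2) a by simp
  qed
  then show "\<exists>e'. range e' \<subseteq> dom_of I \<and> (\<forall>x. x \<notin> set (evars r) \<longrightarrow> e' x = e x) \<and>
      (\<exists>\<psi>\<in>set (heads r). \<forall>a\<in>set \<psi>. holds I e' a)"
    using e2 e1(1) h \<psi>(1) by (intro exI[of _ "\<lambda>x. h (e2 x)"]) auto
qed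

lemma transfer_atomic_implication:
  fixes F :: "('p, 'f, 'v) fm"
  assumes F: "is_atomic_implication F A B"
    and \<A>: "ground_atom A (tuple cp A) \<in> \<A>"
    and \<R>: "A \<noteq> B \<Longrightarrow> ground_atom B (tuple cp A) \<in> \<R>"
    and C: "set (tuple cp A) \<subseteq> C"
    and sat: "satisfies J F"
  shows "satisfies I F"
\<comment> \<open>For \<open>A = B\<close> the formula is valid; relevance of the head fact is given
  for distinct predicates only.\<close>
proof (cases "A = B")
  case True
  then show ?thesis
    using F by (auto simp: is_atomic_implication_def satisfies_atomic_implication[OF I])
next
  case False
  obtain xs where xs: "distinct xs" "length xs = arity A" "length xs = arity B"
    and F_eq: "F = fm_of_rule (atomic_implication A B xs)"
    using F by (auto simp: is_atomic_implication_def)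
  show ?thesis
    unfolding F_eq satisfies_atomic_implication[OF I]
  proof (intro allI impI)
    fix e :: "'v \<Rightarrow> 'u"
    assume e: "range e \<subseteq> dom_of I" and A: "holds I e (Atom A (map Var xs))"
    have len: "length (tuple cp A) = length xs" using xs by (simp add: tuple_def)
    \<comment> \<open>By distinctness of \<open>xs\<close>, its \<open>j\<close>-th variable gets
      the \<open>j\<close>-th constant of the tuple; the default \<open>c0\<close> keeps all other
      tags inside \<open>C\<close>.\<close>
    define c where "c x = (case map_of (zip xs (tuple cp A)) x of None \<Rightarrow> c0 | Some c \<Rightarrow> c)" for x
    have c: "map c xs = tuple cp A"
      using len xs(1) by (intro nth_equalityI) (simp_all add: c_def map_of_zip_nth)
    have "range c \<subseteq> C"
      using C c0 by (auto simp: c_def split: option.split dest!: map_of_SomeD set_zip_rightD)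
    then obtain e1 where e1: "\<And>x. h (e1 x) = e x" "\<And>x. k (e1 x) = c x"
      using lift_assignment[OF e] by blast
    have eq: "map k (map (eval_tm J e1) (args_of (Atom D (map Var xs)))) = tuple cp A"
      for D :: "'p pred"
      using c by (simp add: e1(2) o_def)
    have fact: "is_fact (ground_atom D (tuple cp A))" if "length xs = arity D" for D :: "'p pred"
      using that len by (simp add: is_fact_ground_atom)
    have "holds J e1 (Atom A (map Var xs))"
      by (rule holds_J_facts(1)) (unfold eq, use fact[OF xs(2)] \<A> A in \<open>simp_all add: e1(1)\<close>)
    then have "holds J e1 (Atom B (map Var xs))"
      using sat unfolding F_eq satisfies_atomic_implication[OF is_interp_J] by simp
    then have "holds I (\<lambda>x. h (e1 x)) (Atom B (map Var xs))"
      by (rule holds_J_facts(2)[rotated 2]) (unfold eq, use fact[OF xs(3)] \<R> False in simp_all)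
    then show "holds I e (Atom B (map Var xs))" by (simp add: e1(1))
  qed
qed

end

theorem theorem17:
  fixes T T' :: "('p, 'f, 'v) rule set"
    and \<Sigma> :: "'p pred set"
    and F :: "('p, 'f, 'v) fm"
    and cy :: "'v \<Rightarrow> 'f"
    and cp :: "'p pred \<Rightarrow> nat \<Rightarrow> 'f"
    and st :: 'f
  assumes infinite_type: "infinite (UNIV :: 'u set)"
    and tbox: "is_tbox T"
    and constant_free: "\<forall>r\<in>T. constant_free r"
    and no_shared_evars: "no_shared_evars T"
    and signature: "signature \<Sigma>" "\<Sigma> \<subseteq> sig_tbox T"
    and fresh: "fresh_constants T \<Sigma> cy cp st"
    and sentence: "sentence F"
    and justification: "is_justification TYPE('u) T F T'"
  shows "(sig_fm F \<subseteq> \<Sigma> \<longrightarrow>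
            T' \<subseteq> module T (setting_m T \<Sigma> st) \<and>
            ((\<exists>r. is_rule r \<and> F = fm_of_rule r) \<longrightarrow> T' \<subseteq> module T (setting_q T \<Sigma> cy st)) \<and>
            ((\<exists>r. is_datalog r \<and> F = fm_of_rule r) \<longrightarrow> T' \<subseteq> module T (setting_f T \<Sigma> cy st)) \<and>
            ((\<exists>A B. is_atomic_implication F A B) \<longrightarrow> T' \<subseteq> module T (setting_i T \<Sigma> cy cp))) \<and>
         ((\<exists>A B. is_atomic_implication F A B \<and> A \<in> \<Sigma> \<and> B \<in> sig_tbox T) \<longrightarrow>
            T' \<subseteq> module T (setting_c T \<Sigma> cy cp))"
proof -
  note subset_module = justification_subset_module[OF infinite_type tbox constant_free justification]
  have finY: "finite (evars_tbox T)" using tbox by (auto simp: is_tbox_def evars_tbox_def)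
  have dom: "dom (theta_c T cy) = evars_tbox T" "dom (theta_m T st) = evars_tbox T"
    by (auto simp: theta_c_def theta_m_def dom_def)
  have ran: "ran (theta_c T cy) \<subseteq> cy ` evars_tbox T" "ran (theta_m T st) \<subseteq> {st}"
    by (auto simp: theta_c_def theta_m_def ran_def split: if_splits)
  have \<Sigma>: "Falsum \<in> \<Sigma>" "Verum \<in> \<Sigma>" using signature(1) by (auto simp: signature_def)
  have f: "ground_atom Falsum [] \<in> A0_f \<Sigma> st" "ground_atom Verum [] \<in> A0_f \<Sigma> st"
    using \<Sigma> by (force simp: A0_f_def)+
  have q: "ground_atom Falsum [] \<in> Ar_q T \<Sigma> cy st" using \<Sigma> by (force simp: Ar_q_def)
  \<comment> \<open>Nullary predicates have the empty tuple, so \<open>A = Verum\<close> and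
    \<open>B = Falsum\<close> make falsity a relevant fact.\<close>
  have i: "ground_atom Verum [] \<in> A0_i \<Sigma> cp" "ground_atom Falsum [] \<in> Ar_i \<Sigma> cp"
    using \<Sigma> by (force simp: A0_i_def Ar_i_def tuple_def)+
  have c: "ground_atom Falsum [] \<in> Ar_c T \<Sigma> cp"
    using i(2) signature(2) by (auto simp: Ar_i_def Ar_c_def)
  let ?Y = "insert st (cy ` evars_tbox T)"
  have ranY: "ran (theta_c T cy) \<subseteq> ?Y" "finite ?Y" "st \<in> ?Y" using ran finY by auto
  have m_sub: "T' \<subseteq> module T (setting_m T \<Sigma> st)" if "sig_fm F \<subseteq> \<Sigma>"
    unfolding setting_m_def
  proof (rule subset_module[where C = "{st}" and ?c0.0 = st])
    fix I :: "('p, 'f, 'u) interp" and h k s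
    assume pm: "product_model T (theta_m T st) (A0_f \<Sigma> st) (A0_f \<Sigma> st) I {st} st h k s"
      and sat: "satisfies
        (product_model.J T (theta_m T st) (A0_f \<Sigma> st) (A0_f \<Sigma> st) I st h k s) F"
    show "satisfies I F"
      by (rule product_model.transfer_formula[OF pm refl sentence that refl refl sat])
  qed (use dom ran f in simp_all)
  have q_sub: "T' \<subseteq> module T (setting_q T \<Sigma> cy st)"
    if "sig_fm F \<subseteq> \<Sigma>" "is_rule r" "F = fm_of_rule r" for r
    unfolding setting_q_def
  proof (rule subset_module[where C = ?Y and ?c0.0 = st])
    fix I :: "('p, 'f, 'u) interp" and h k s
    assume pm: "product_model T (theta_c T cy) (A0_f \<Sigma> st) (Ar_q T \<Sigma> cy st) I ?Y st h k s"
      and sat: "satisfies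
        (product_model.J T (theta_c T cy) (A0_f \<Sigma> st) (Ar_q T \<Sigma> cy st) I st h k s) F"
    \<comment> \<open>Existential witnesses may carry any tag from \<open>?Y\<close>, and
      \<open>Ar_q\<close> contains all tuples over it.\<close>
    show "satisfies I F"
      unfolding that(3)
      by (rule product_model.transfer_rule[OF pm that(2) _ refl])
        (use that sat in \<open>auto simp: Ar_q_def\<close>)
  qed (use dom ranY f q in simp_all)
  have f_sub: "T' \<subseteq> module T (setting_f T \<Sigma> cy st)"
    if "sig_fm F \<subseteq> \<Sigma>" "is_datalog r" "F = fm_of_rule r" for r
    unfolding setting_f_def
  proof (rule subset_module[where C = ?Y and ?c0.0 = st])
    fix I :: "('p, 'f, 'u) interp" and h k s
    assume pm: "product_model T (theta_c T cy) (A0_f \<Sigma> st) (A0_f \<Sigma> st) I ?Y st h k s"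
      and sat: "satisfies
        (product_model.J T (theta_c T cy) (A0_f \<Sigma> st) (A0_f \<Sigma> st) I st h k s) F"
    have r: "is_rule r" "evars r = []" using that(2) by (auto simp: is_datalog_def)
    \<comment> \<open>Without existential variables the head yields only tuples of
      \<open>st\<close>, and \<open>A0_f\<close> consists of these.\<close>
    have \<R>: "ground_atom A cs \<in> A0_f \<Sigma> st"
      if "A \<in> \<Sigma>" "length cs = arity A" "set cs \<subseteq> {st}" for A :: "'p pred" and cs
    proof -
      have "cs = replicate (arity A) st" using that by (intro replicate_eqI) auto
      then show ?thesis using that(1) by (auto simp: A0_f_def)
    qed
    show "satisfies I F"
      unfolding that(3)
      by (rule product_model.transfer_rule[OF pm r(1) _ refl]) (use that sat r \<R> in auto)
  qed (use dom ranY f in simp_all)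
  \<comment> \<open>Common core of the settings i and c: the relevant facts stay open, apart from
    falsity and the fact of \<open>B\<close> about the tuple of \<open>A\<close>.\<close>
  have tuple_sub: "T' \<subseteq> module T (theta_c T cy, A0_i \<Sigma> cp, \<R>)"
    if "is_atomic_implication F A B" "A \<in> \<Sigma>" "ground_atom Falsum [] \<in> \<R>"
      "A \<noteq> B \<Longrightarrow> ground_atom B (tuple cp A) \<in> \<R>" for A B \<R>
  proof (rule subset_module[where C = "?Y \<union> set (tuple cp A)" and ?c0.0 = st])
    fix I :: "('p, 'f, 'u) interp" and h k s
    assume pm: "product_model T (theta_c T cy) (A0_i \<Sigma> cp) \<R> I (?Y \<union> set (tuple cp A)) st h k s"
      and sat: "satisfies (product_model.J T (theta_c T cy) (A0_i \<Sigma> cp) \<R> I st h k s) F"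
    have "ground_atom A (tuple cp A) \<in> A0_i \<Sigma> cp" using that(2) by (auto simp: A0_i_def)
    then show "satisfies I F"
      by (rule product_model.transfer_atomic_implication[OF pm that(1)])
        (use that sat in auto)
  qed (use dom ranY i that in auto)
  have i_sub: "T' \<subseteq> module T (setting_i T \<Sigma> cy cp)"
    if sig: "sig_fm F \<subseteq> \<Sigma>" and imp: "is_atomic_implication F A B" for A B
  proof -
    obtain xs where "arity A = arity B" "F = fm_of_rule (atomic_implication A B xs)"
      using imp by (auto simp: is_atomic_implication_def)
    moreover from this have "A \<in> \<Sigma>" "B \<in> \<Sigma>"
      using sig pred_of_rule_in_sig[of "Atom A (map Var xs)" "atomic_implication A B xs"]
        pred_of_rule_in_sig[of "Atom B (map Var xs)" "atomic_implication A B xs"]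
      by (auto simp: atomic_implication_def atoms_rule_def)
    ultimately show ?thesis
      unfolding setting_i_def using imp i by (intro tuple_sub) (auto simp: Ar_i_def)
  qed
  have c_sub: "T' \<subseteq> module T (setting_c T \<Sigma> cy cp)"
    if "is_atomic_implication F A B" "A \<in> \<Sigma>" "B \<in> sig_tbox T" for A B
  proof -
    have "arity A = arity B" using that(1) by (auto simp: is_atomic_implication_def)
    then show ?thesis
      unfolding setting_c_def using that c by (intro tuple_sub) (auto simp: Ar_c_def)
  qed
  show ?thesis using m_sub q_sub f_sub i_sub c_sub by blast
qed

end
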